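(* Let $q$ be a complex number with $0<|q|<1$ and let $a,b,c,d$ be nonzero complex numbers such that no denominator occurring below vanishes. Then $$\frac{(b;q)_\infty(qc;q)_\infty(qd;q)_\infty(qa^2/bcd;q)_\infty}{(qa/b;q)_\infty(qa/c;q)_\infty(qa/d;q)_\infty(bcd/a;q)_\infty} =\sum_{n=0}^{\infty}W_n(a,b,c,d)\left(\frac{q^{3n}a^3}{bcd}\right)^n\frac{(b,\,c,\,qd,\,qa/bc,\,qa/bd,\,qa/cd;q)_n\,(bc/a,\,bd/a,\,cd/a;q)_{2n}}{(qa/b,\,qa/c,\,qa/d;q)_{2n}\,(q,\,bcd/a;q)_{3n}},$$ where $$W_n(a,b,c,d)=\frac{(1-q^{2n}bd/a)(1-q^{1+n}a/(bc))(1-q^{2n}cd/a)(1-q^{1+4n}c)}{(1-q^{1+3n})(1-c)(1-q^{1+2n}a/b)(1-q^{3n}bcd/a)}$$ $$\times\Bigg\{q^{2n}\frac ad+\frac{(1-q^{2n}a/d)(1-q^{3n}bcd/a)(1-q^{4n}d)(1-q^{1+2n}a/b)(1-q^{1+3n})}{(1-q^{n}d)(1-q^{2n}bd/a)(1-q^{2n}cd/a)(1-q^{1+n}a/(bc))(1-q^{1+4n}c)}$$ $$+\frac{q^{1+4n}a^2(1-q^{n}c)(1-q^{2n}bc/a)(1-q^{1+n}a/(bd))(1-q^{1+2n}cd/a)(1-q^{2+4n}b)}{cd\,(1-q^{1+2n}a/c)(1-q^{1+2n}a/d)(1-q^{1+3n}bcd/a)(1-q^{2+3n})(1-q^{1+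4n}c)}\Bigg\}.$$
   Context: $(x;q)_0=1$, $(x;q)_n=\prod_{j=0}^{n-1}(1-q^jx)$ for $n\ge1$, $(x;q)_\infty=\prod_{j\ge0}(1-q^jx)$, and $(x_1,\dots,x_r;q)_n=(x_1;q)_n\cdots(x_r;q)_n$. Expressions such as $qa/bc$ mean $qa/(bc)$. *)

theory Defs
  imports "HOL-Analysis.Analysis"
begin

definition qpoch :: "complex \<Rightarrow> complex \<Rightarrow> nat \<Rightarrow> complex" where
  "qpoch x q n = (\<Prod>j<n. 1 - q ^ j * x)"

(* For norm q < 1 the factors tend to 1 geometrically, so the product converges in the sense of
   has_prod. That notion tolerates finitely many vanishing factors, the value then being 0. *)
definition qpoch_inf :: "complex \<Rightarrow> complex \<Rightarrow> complex" where
  "qpoch_inf x q = (\<Prod>j. 1 - q ^ j * x)"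

(* The multi-parameter symbol (x_1, ..., x_r; q)_n. *)
definition qpochs :: "complex list \<Rightarrow> complex \<Rightarrow> nat \<Rightarrow> complex" where
  "qpochs xs q n = (\<Prod>x\<leftarrow>xs. qpoch x q n)"

definition W ::
  "complex \<Rightarrow> nat \<Rightarrow> complex \<Rightarrow> complex \<Rightarrow> complex \<Rightarrow> complex \<Rightarrow> complex" where
  "W q n a b c d =
     ((1 - q ^ (2*n) * (b*d/a)) * (1 - q ^ (1+n) * (a/(b*c)))
        * (1 - q ^ (2*n) * (c*d/a)) * (1 - q ^ (1+4*n) * c))
     / ((1 - q ^ (1+3*n)) * (1 - c) * (1 - q ^ (1+2*n) * (a/b)) * (1 - q ^ (3*n) * (b*c*d/a)))
     * (q ^ (2*n) * (a/d)
        + ((1 - q ^ (2*n) * (a/d)) * (1 - q ^ (3*n) * (b*c*d/a)) * (1 - q ^ (4*n) * d)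
             * (1 - q ^ (1+2*n) * (a/b)) * (1 - q ^ (1+3*n)))
          / ((1 - q ^ n * d) * (1 - q ^ (2*n) * (b*d/a)) * (1 - q ^ (2*n) * (c*d/a))
             * (1 - q ^ (1+n) * (a/(b*c))) * (1 - q ^ (1+4*n) * c))
        + (q ^ (1+4*n) * a^2 * (1 - q ^ n * c) * (1 - q ^ (2*n) * (b*c/a))
             * (1 - q ^ (1+n) * (a/(b*d))) * (1 - q ^ (1+2*n) * (c*d/a)) * (1 - q ^ (2+4*n) * b))
          / (c * d * (1 - q ^ (1+2*n) * (a/c)) * (1 - q ^ (1+2*n) * (a/d))
             * (1 - q ^ (1+3*n) * (b*c*d/a)) * (1 - q ^ (2+3*n)) * (1 - q ^ (1+4*n) * c)))"

end

theory Submission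
  imports Defs
begin

text \<open>
  Put \<open>\<Omega>(a; b, c, d, e) = (\<Sum>k. (1 - q\<^sup>2\<^sup>k a) (b, c, d, e; q)\<^sub>k / (qa/b, qa/c, qa/d, qa/e; q)\<^sub>k z\<^sup>k)\<close>
  with \<open>z = q a\<^sup>2 / (b c d e)\<close>. Summation by parts expresses \<open>\<Omega>(a; b, c, d, e)\<close> as an elementary
  term plus a multiple of \<open>\<Omega>(qa; qb, c, d, e)\<close>, and by symmetry the same holds for \<open>c\<close> and \<open>d\<close>.
  With \<open>e = q a\<^sup>2 / (b c d)\<close> the series \<open>\<Omega>(qa; b, c, qd, e)\<close> has argument \<open>q\<close> and telescopes; this
  yields the infinite product, up to the factor \<open>1 - c\<close> and the additive term \<open>1 - a/d\<close>.
  Raising \<open>c\<close>, \<open>b\<close>, \<open>d\<close> in turn, again and again, leads from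
  \<open>\<Omega>(q\<^sup>3\<^sup>n\<^sup>+\<^sup>1 a; q\<^sup>n b, q\<^sup>n c, q\<^sup>n\<^sup>+\<^sup>1 d, e)\<close> to its successor. The elementary terms are, in this order, the
  first and third summand of \<open>W\<^sub>n\<close> and the second summand of \<open>W\<^sub>n\<^sub>+\<^sub>1\<close>, where the second summand of
  \<open>W\<^sub>0\<close> is \<open>1 - a/d\<close> up to normalization. The remainder tends to 0 because its coefficient
  decays like \<open>q\<close> to the power \<open>3n\<^sup>2\<close>.
\<close>

section \<open>q-Pochhammer symbols: shifts, limits, and bounds uniform in the shift\<close>

lemma qpoch_Suc: "qpoch x q (Suc n) = qpoch x q n * (1 - q ^ n * x)"
  by (simp add: qpoch_def)

lemma qpoch_add: "qpoch x q (m + n) = qpoch x q m * qpoch (q ^ m * x) q n"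
  by (induction n) (simp_all add: qpoch_def power_add mult_ac)

lemma qpoch_Suc_shift: "qpoch x q (Suc n) = (1 - x) * qpoch (q * x) q n"
  using qpoch_add[of x q 1 n] by (simp add: qpoch_def)

lemma qpoch_tendsto:
  assumes "norm q < 1"
  shows "(\<lambda>n. qpoch x q n) \<longlonglongrightarrow> qpoch_inf x q"
proof -
  have "abs_convergent_prod (\<lambda>j. 1 - q ^ j * x)"
    unfolding abs_convergent_prod_conv_summable using assms
    by (simp add: norm_mult norm_power summable_mult2)
  then have "(\<lambda>n. \<Prod>j\<le>n. 1 - q ^ j * x) \<longlonglongrightarrow> (\<Prod>j. 1 - q ^ j * x)"
    by (intro convergent_prod_LIMSEQ abs_convergent_prod_imp_convergent_prod)
  then have "(\<lambda>n. qpoch x q (Suc n)) \<longlonglongrightarrow> qpoch_inf x q"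
    by (simp add: qpoch_def qpoch_inf_def lessThan_Suc_atMost del: prod.lessThan_Suc)
  then show ?thesis by (rule LIMSEQ_imp_Suc)
qed

text \<open>A product that converges in the sense of \<open>has_prod\<close> vanishes only through
  one of its factors. This links nonvanishing of \<open>qpoch_inf\<close> with nonvanishing of all
  finite symbols, in both directions.\<close>

lemma qpoch_inf_eq_0_iff:
  assumes "norm q < 1"
  shows "qpoch_inf x q = 0 \<longleftrightarrow> (\<exists>j. q ^ j * x = 1)"
proof -
  have "abs_convergent_prod (\<lambda>j. 1 - q ^ j * x)"
    unfolding abs_convergent_prod_conv_summable using assms
    by (simp add: norm_mult norm_power summable_mult2)
  then have "(\<lambda>j. 1 - q ^ j * x) has_prod qpoch_inf x q"
    unfolding qpoch_inf_def
    by (intro convergent_prod_has_prod abs_convergent_prod_imp_convergent_prod)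
  from has_prod_eq_0_iff[OF this] show ?thesis
    by auto
qed

lemma qpoch_eq_0_iff: "qpoch x q n = 0 \<longleftrightarrow> (\<exists>j<n. q ^ j * x = 1)"
  by (auto simp: qpoch_def)

text \<open>Each factor satisfies \<open>norm (1 - y) \<le> exp (norm y)\<close>, and the shift by
  \<open>q ^ m\<close> never enlarges \<open>y\<close>. Uniformity in \<open>m\<close> matters
  because the parameters of the series move by powers of \<open>q\<close> during the
  iteration.\<close>

lemma qpoch_bounded:
  assumes "norm q < 1"
  obtains M where "M > 0" "\<And>m n. norm (qpoch (q ^ m * x) q n) \<le> M"
proof -
  have "summable (\<lambda>j. norm q ^ j * norm x)"
    using assms by (simp add: summable_mult2)
  then have s: "(\<Sum>j<n. norm q ^ j * norm x) \<le> (\<Sum>j. norm q ^ j * norm x)" for n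
    by (intro sum_le_suminf) auto
  have "norm (qpoch (q ^ m * x) q n) \<le> exp (\<Sum>j. norm q ^ j * norm x)" for m n
  proof -
    have "norm (qpoch (q ^ m * x) q n) = (\<Prod>j<n. norm (1 - q ^ j * (q ^ m * x)))"
      by (simp add: qpoch_def prod_norm)
    also have "\<dots> \<le> (\<Prod>j<n. exp (norm q ^ j * norm x))"
    proof (intro prod_mono conjI norm_ge_zero)
      fix j
      have "norm (1 - q ^ j * (q ^ m * x)) \<le> 1 + norm q ^ j * (norm q ^ m * norm x)"
        using norm_triangle_ineq4[of 1 "q ^ j * (q ^ m * x)"] by (simp add: norm_mult norm_power)
      also have "norm q ^ m * norm x \<le> norm x"
        using assms by (simp add: mult_left_le_one_le power_le_one)
      then have "1 + norm q ^ j * (norm q ^ m * norm x) \<le> 1 + norm q ^ j * norm x"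
        by (simp add: mult_left_mono)
      also have "\<dots> \<le> exp (norm q ^ j * norm x)"
        by (rule exp_ge_add_one_self)
      finally show "norm (1 - q ^ j * (q ^ m * x)) \<le> exp (norm q ^ j * norm x)" .
    qed
    also have "\<dots> = exp (\<Sum>j<n. norm q ^ j * norm x)"
      by (simp add: exp_sum)
    also have "\<dots> \<le> exp (\<Sum>j. norm q ^ j * norm x)"
      using s by simp
    finally show ?thesis .
  qed
  then show ?thesis by (intro that[of "exp (\<Sum>j. norm q ^ j * norm x)"]) auto
qed

text \<open>The shifted symbol is the quotient of \<open>qpoch x q (m + n)\<close> by
  \<open>qpoch x q m\<close>. Its inverse is therefore a bounded symbol times an inverse symbol that
  converges, since the infinite product is nonzero.\<close>

lemma qpoch_bounded_below:
  assumes q: "norm q < 1" and nz: "\<And>n. qpoch x q n \<noteq> 0"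
  obtains M where "M > 0" "\<And>m n. norm (inverse (qpoch (q ^ m * x) q n)) \<le> M"
proof -
  have "qpoch_inf x q \<noteq> 0"
    using nz q by (auto simp: qpoch_inf_eq_0_iff qpoch_eq_0_iff)
  then have "(\<lambda>n. inverse (qpoch x q n)) \<longlonglongrightarrow> inverse (qpoch_inf x q)"
    using qpoch_tendsto[OF q] by (intro tendsto_inverse)
  then have "Bseq (\<lambda>n. inverse (qpoch x q n))"
    by (rule convergent_imp_Bseq[OF convergentI])
  then obtain K where K: "K > 0" "\<And>n. norm (inverse (qpoch x q n)) \<le> K"
    by (auto simp: Bseq_def)
  obtain L where L: "L > 0" "\<And>m n. norm (qpoch (q ^ m * x) q n) \<le> L"
    using qpoch_bounded[OF q] by blast
  have "norm (inverse (qpoch (q ^ m * x) q n)) \<le> L * K" for m n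
  proof -
    have "inverse (qpoch (q ^ m * x) q n) = qpoch x q m * inverse (qpoch x q (m + n))"
      using nz[of m] by (simp add: qpoch_add field_simps)
    then show ?thesis
      using K(1) K(2)[of "m + n"] L(1) L(2)[of 0 m] by (simp add: norm_mult mult_mono del: norm_inverse)
  qed
  with K(1) L(1) show ?thesis by (intro that[of "L * K"]) auto
qed

section \<open>Very-well-poised series and their contiguous relation\<close>

text \<open>This is the summation by parts at \<open>x = q ^ k\<close>, with common symbols removed
  and denominators cleared. The left side stems from the given summand, the first term on the right
  from the summand with \<open>a\<close> and \<open>b\<close> raised, the last two from the boundary
  quantity at \<open>k\<close> and at \<open>k + 1\<close>.\<close>

lemma contiguous_poly:
  fixes x q a b c d e z :: complex
  assumes "a \<noteq> 0" "b \<noteq> 0" "c \<noteq> 0" "d \<noteq> 0" "e \<noteq> 0" and z: "z = q*a^2/(b*c*d*e)"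
  shows "(1 - z) * ((1 - x^2*a) * (1 - x*(q*a/c)) * (1 - x*(q*a/d)) * (1 - x*(q*a/e)))
    = a/b * (1 - q*a/(c*d)) * (1 - q*a/(c*e)) * (1 - q*a/(d*e)) * x * (1 - x^2*(q*a)) * (1 - x*b)
      + (1 - x*(z*b)) * (1 - x*a/b) * (1 - x*(q*a/c)) * (1 - x*(q*a/d)) * (1 - x*(q*a/e))
      - z * (1 - q*x*(z*b)) * (1 - x*b) * (1 - x*c) * (1 - x*d) * (1 - x*e)"
proof -
  \<comment> \<open>With named reciprocals the claim becomes a polynomial identity modulo relations
    such as \<open>b * B = 1\<close>, which \<open>algebra\<close> can decide.\<close>
  define B where "B = inverse b"
  define C where "C = inverse c"
  define D where "D = inverse d"
  define E where "E = inverse e"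
  have i: "b * B = 1" "c * C = 1" "d * D = 1" "e * E = 1"
    using assms by (auto simp: B_def C_def D_def E_def)
  have z': "z = q*a^2*B*C*D*E" by (simp add: z B_def C_def D_def E_def divide_inverse mult_ac)
  have "(1 - z) * ((1 - x^2*a) * (1 - x*(q*a*C)) * (1 - x*(q*a*D)) * (1 - x*(q*a*E)))
    = a*B * (1 - q*a*C*D) * (1 - q*a*C*E) * (1 - q*a*D*E) * x * (1 - x^2*(q*a)) * (1 - x*b)
      + (1 - x*(z*b)) * (1 - x*a*B) * (1 - x*(q*a*C)) * (1 - x*(q*a*D)) * (1 - x*(q*a*E))
      - z * (1 - q*x*(z*b)) * (1 - x*b) * (1 - x*c) * (1 - x*d) * (1 - x*e)"
    using i unfolding z' by algebra
  then show ?thesis by (simp add: B_def C_def D_def E_def divide_inverse mult_ac)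
qed
text \<open>The summand of a very-well-poised series whose argument \<open>q a\<^sup>2 / (b c d e)\<close> is tied to its parameters.
  There is no factor \<open>(a; q)\<^sub>k / (q; q)\<^sub>k\<close>: it would be the special case \<open>e = a\<close>.\<close>

definition vwp ::
  "complex \<Rightarrow> complex \<Rightarrow> complex \<Rightarrow> complex \<Rightarrow> complex \<Rightarrow> complex \<Rightarrow> nat \<Rightarrow> complex" where
  "vwp q a b c d e k =
     (1 - (q ^ k)^2 * a) * (qpoch b q k * qpoch c q k * qpoch d q k * qpoch e q k)
     / (qpoch (q*a/b) q k * qpoch (q*a/c) q k * qpoch (q*a/d) q k * qpoch (q*a/e) q k)
     * (q*a^2/(b*c*d*e)) ^ k"

lemma vwp_commute:
  "vwp q a c b d e = vwp q a b c d e" "vwp q a d b c e = vwp q a b c d e"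
  by (auto simp: vwp_def fun_eq_iff mult_ac)

text \<open>One constant serves all shifts and all \<open>k\<close>, so the whole family of series
  met in the iteration has a common majorant.\<close>

lemma qpoch_quotient_bounded:
  assumes q: "norm q < 1"
    and nz: "\<And>k. qpoch \<beta> q k \<noteq> 0" "\<And>k. qpoch \<gamma> q k \<noteq> 0" "\<And>k. qpoch \<delta> q k \<noteq> 0" "\<And>k. qpoch \<epsilon> q k \<noteq> 0"
  shows "\<exists>M>0. \<forall>r s t u r' s' t' u' k. norm
       (qpoch (q^r*b) q k * qpoch (q^s*c) q k * qpoch (q^t*d) q k * qpoch (q^u*e) q k
        / (qpoch (q^r'*\<beta>) q k * qpoch (q^s'*\<gamma>) q k * qpoch (q^t'*\<delta>) q k * qpoch (q^u'*\<epsilon>) q k)) \<le> M"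
proof -
  obtain B where B: "B > 0" "\<And>m n. norm (qpoch (q^m*b) q n) \<le> B" using qpoch_bounded[OF q] by blast
  obtain C where C: "C > 0" "\<And>m n. norm (qpoch (q^m*c) q n) \<le> C" using qpoch_bounded[OF q] by blast
  obtain D where D: "D > 0" "\<And>m n. norm (qpoch (q^m*d) q n) \<le> D" using qpoch_bounded[OF q] by blast
  obtain E where E: "E > 0" "\<And>m n. norm (qpoch (q^m*e) q n) \<le> E" using qpoch_bounded[OF q] by blast
  obtain B' where B': "B' > 0" "\<And>m n. norm (inverse (qpoch (q^m*\<beta>) q n)) \<le> B'"
    using qpoch_bounded_below[OF q nz(1)] by blast
  obtain C' where C': "C' > 0" "\<And>m n. norm (inverse (qpoch (q^m*\<gamma>) q n)) \<le> C'"
    using qpoch_bounded_below[OF q nz(2)] by blast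
  obtain D' where D': "D' > 0" "\<And>m n. norm (inverse (qpoch (q^m*\<delta>) q n)) \<le> D'"
    using qpoch_bounded_below[OF q nz(3)] by blast
  obtain E' where E': "E' > 0" "\<And>m n. norm (inverse (qpoch (q^m*\<epsilon>) q n)) \<le> E'"
    using qpoch_bounded_below[OF q nz(4)] by blast
  show ?thesis
  proof (intro exI[of _ "B * C * D * E * (B' * C' * D' * E')"] conjI allI)
    show "B * C * D * E * (B' * C' * D' * E') > 0"
      using B C D E B' C' D' E' by simp
  next
    fix r s t u r' s' t' u' k
    show "norm (qpoch (q^r*b) q k * qpoch (q^s*c) q k * qpoch (q^t*d) q k * qpoch (q^u*e) q k
        / (qpoch (q^r'*\<beta>) q k * qpoch (q^s'*\<gamma>) q k * qpoch (q^t'*\<delta>) q k * qpoch (q^u'*\<epsilon>) q k))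
       \<le> B * C * D * E * (B' * C' * D' * E')"
      unfolding divide_inverse inverse_mult_distrib norm_mult
      using B(1) C(1) D(1) E(1) B'(1) C'(1) D'(1) E'(1)
      by (intro mult_mono B(2) C(2) D(2) E(2) B'(2) C'(2) D'(2) E'(2) mult_nonneg_nonneg norm_ge_zero) auto
  qed
qed

lemma norm_vwp_le:
  assumes q: "norm q < 1" and
    M: "norm (qpoch b q k * qpoch c q k * qpoch d q k * qpoch e q k
        / (qpoch (q*a/b) q k * qpoch (q*a/c) q k * qpoch (q*a/d) q k * qpoch (q*a/e) q k)) \<le> M"
  shows "norm (vwp q a b c d e k) \<le> (1 + norm a) * M * norm (q*a^2/(b*c*d*e)) ^ k"
proof -
  have "norm (1 - (q ^ k)^2 * a) \<le> 1 + norm ((q ^ k)^2 * a)"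
    using norm_triangle_ineq4[of 1 "(q ^ k)^2 * a"] by simp
  also have "norm ((q ^ k)^2 * a) \<le> norm a"
    using q by (simp add: norm_mult norm_power mult_left_le_one_le power_le_one)
  finally have "norm (1 - (q ^ k)^2 * a) \<le> 1 + norm a" by simp
  then have "norm (1 - (q ^ k)^2 * a) * norm (qpoch b q k * qpoch c q k * qpoch d q k * qpoch e q k
        / (qpoch (q*a/b) q k * qpoch (q*a/c) q k * qpoch (q*a/d) q k * qpoch (q*a/e) q k))
      \<le> (1 + norm a) * M"
    using M by (intro mult_mono) auto
  then have "norm (1 - (q ^ k)^2 * a) * norm (qpoch b q k * qpoch c q k * qpoch d q k * qpoch e q k
        / (qpoch (q*a/b) q k * qpoch (q*a/c) q k * qpoch (q*a/d) q k * qpoch (q*a/e) q k))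
        * norm (q*a^2/(b*c*d*e)) ^ k \<le> (1 + norm a) * M * norm (q*a^2/(b*c*d*e)) ^ k"
    by (rule mult_right_mono) simp
  then show ?thesis
    unfolding vwp_def by (simp only: norm_mult norm_power times_divide_eq_right[symmetric])
qed

text \<open>Raising \<open>a\<close> and \<open>b\<close> by a factor \<open>q\<close> keeps
  \<open>q*a/b\<close>, moves the other three denominator parameters by \<open>q\<close> and
  multiplies the argument by \<open>q\<close>. Convergence is transferred from the raised series to
  the original one; \<open>norm z < 1\<close> makes the boundary term vanish at infinity and allows
  the division by \<open>1 - z\<close>.\<close>

lemma vwp_sums_contiguous:
  fixes q a b c d e z :: complex
  assumes q: "q \<noteq> 0" "norm q < 1" and nz: "a \<noteq> 0" "b \<noteq> 0" "c \<noteq> 0" "d \<noteq> 0" "e \<noteq> 0"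
    and z: "z = q*a^2/(b*c*d*e)" "norm z < 1"
    and den: "\<And>k. qpoch (q*a/b) q k \<noteq> 0" "\<And>k. qpoch (q*a/c) q k \<noteq> 0"
      "\<And>k. qpoch (q*a/d) q k \<noteq> 0" "\<And>k. qpoch (q*a/e) q k \<noteq> 0"
    and S: "vwp q (q*a) (q*b) c d e sums S"
  shows "vwp q a b c d e sums
    (((1 - z*b) * (1 - a/b) + a/b * (1 - b) * (1 - q*a/(c*d)) * (1 - q*a/(c*e)) * (1 - q*a/(d*e))
      / ((1 - q*a/c) * (1 - q*a/d) * (1 - q*a/e)) * S) / (1 - z))"
proof -
  \<comment> \<open>\<open>K\<close> is the constant of \<open>contiguous_poly\<close>;
    \<open>V\<close> absorbs the factors that appear when the symbols of the raised summand are
    expressed through those of the original one.\<close>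
  define K where "K = a/b * (1 - q*a/(c*d)) * (1 - q*a/(c*e)) * (1 - q*a/(d*e))"
  define V where "V = (1 - b) / ((1 - q*a/c) * (1 - q*a/d) * (1 - q*a/e))"
  define Q where "Q k = qpoch b q k * qpoch c q k * qpoch d q k * qpoch e q k
     / (qpoch (q*a/b) q k * qpoch (q*a/c) q k * qpoch (q*a/d) q k * qpoch (q*a/e) q k)" for k
  \<comment> \<open>The certificate: \<open>(1 - z) F\<close> and the multiple of the shifted summand differ by \<open>r k - r (k + 1)\<close>.\<close>
  define r where "r k = (1 - q^k*(z*b)) * (1 - q^k*a/b) * (Q k * z^k)" for k
  have z1: "1 - z \<noteq> 0" using z(2) by auto
  have eq: "(1 - z) * vwp q a b c d e k = K * (V * vwp q (q*a) (q*b) c d e k) + (r k - r (Suc k))" for k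
  proof -
    define x where "x = q ^ k"
    define C where "C = Q k * z^k"
    define f3 where "f3 = (1 - x*(q*a/c)) * (1 - x*(q*a/d)) * (1 - x*(q*a/e))"
    have n: "1 - x*(q*a/b) \<noteq> 0" "1 - x*(q*a/c) \<noteq> 0" "1 - x*(q*a/d) \<noteq> 0" "1 - x*(q*a/e) \<noteq> 0"
      using den(1)[of "Suc k"] den(2)[of "Suc k"] den(3)[of "Suc k"] den(4)[of "Suc k"]
      by (auto simp: qpoch_Suc x_def)
    have n1: "1 - q*a/c \<noteq> 0" "1 - q*a/d \<noteq> 0" "1 - q*a/e \<noteq> 0"
      using den(2)[of 1] den(3)[of 1] den(4)[of 1] by (auto simp: qpoch_def)
    have f3: "f3 \<noteq> 0" using n by (simp add: f3_def)
    have F: "vwp q a b c d e k = (1 - x^2*a) * C"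
      by (simp add: vwp_def C_def Q_def x_def z(1))
    have sh: "qpoch (q*y) q k = qpoch y q k * (1 - x*y) / (1 - y)" if "1 - y \<noteq> 0" for y
      using that qpoch_Suc_shift[of y q k] qpoch_Suc[of y q k] by (simp add: x_def field_simps)
    have shb: "(1 - b) * qpoch (q*b) q k = qpoch b q k * (1 - x*b)"
      using qpoch_Suc_shift[of b q k] qpoch_Suc[of b q k] by (simp add: x_def)
    have ar: "q*(q*a)/(q*b) = q*a/b" "q*(q*a)/c = q*(q*a/c)" "q*(q*a)/d = q*(q*a/d)" "q*(q*a)/e = q*(q*a/e)"
      "q*(q*a)^2/(q*b*c*d*e) = q*z"
      using q(1) by (simp_all add: z(1) field_simps power2_eq_square)
    have "V * vwp q (q*a) (q*b) c d e k = (1 - x^2*(q*a)) * ((1 - b) * qpoch (q*b) q k)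
        * (qpoch c q k * qpoch d q k * qpoch e q k)
        / (qpoch (q*a/b) q k * (qpoch (q*(q*a/c)) q k * (1 - q*a/c))
           * (qpoch (q*(q*a/d)) q k * (1 - q*a/d)) * (qpoch (q*(q*a/e)) q k * (1 - q*a/e))) * (q*z)^k"
      unfolding vwp_def ar V_def by (simp add: x_def mult_ac)
    also have "\<dots> = (1 - x^2*(q*a)) * (1 - x*b) * x * C / f3"
      unfolding shb sh[OF n1(1)] sh[OF n1(2)] sh[OF n1(3)]
      using n1 by (simp add: C_def Q_def f3_def x_def power_mult_distrib) (simp only: mult_ac)
    finally have F': "V * vwp q (q*a) (q*b) c d e k = x * (1 - x^2*(q*a)) * (1 - x*b) * C / f3"
      by (simp only: mult_ac)
    have r0: "r k = (1 - x*(z*b)) * (1 - x*a/b) * C"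
      by (simp add: r_def C_def x_def)
    have xb: "1 - q * x * a / b \<noteq> 0" using n(1) by (simp add: mult_ac)
    \<comment> \<open>The new denominator factor \<open>1 - q*x*a/b\<close> cancels against the
      second factor of \<open>r (Suc k)\<close>, which leaves only \<open>f3\<close> as
      denominator.\<close>
    have "Q (Suc k) = Q k * ((1 - x*b) * (1 - x*c) * (1 - x*d) * (1 - x*e)) / ((1 - q*x*a/b) * f3)"
      by (simp add: Q_def qpoch_Suc f3_def x_def mult_ac)
    then have r1: "r (Suc k) = z * (1 - q*x*(z*b)) * (1 - x*b) * (1 - x*c) * (1 - x*d) * (1 - x*e) * C / f3"
      using xb f3 nz(2) by (simp add: r_def C_def x_def[symmetric])
    have p: "(1 - z) * ((1 - x^2*a) * f3) = K * (x * (1 - x^2*(q*a)) * (1 - x*b))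
        + (1 - x*(z*b)) * (1 - x*a/b) * f3
        - z * (1 - q*x*(z*b)) * (1 - x*b) * (1 - x*c) * (1 - x*d) * (1 - x*e)"
      using contiguous_poly[OF nz z(1), where x = x] by (simp only: f3_def K_def mult.assoc)
    have "(1 - z) * vwp q a b c d e k * f3 = ((1 - z) * ((1 - x^2*a) * f3)) * C"
      by (simp add: F)
    also have "\<dots> = (K * (V * vwp q (q*a) (q*b) c d e k) + (r k - r (Suc k))) * f3"
    proof -
      \<comment> \<open>Keeping the three products opaque reduces the comparison to clearing the
        single denominator \<open>f3\<close>.\<close>
      have "(K * t1 + t2 * f3 - t3) * C = (K * (t1 * C / f3) + (t2 * C - t3 * C / f3)) * f3" for t1 t2 t3
        using f3 by (simp add: field_simps)
      from this[of "x * (1 - x^2*(q*a)) * (1 - x*b)" "(1 - x*(z*b)) * (1 - x*a/b)"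
          "z * (1 - q*x*(z*b)) * (1 - x*b) * (1 - x*c) * (1 - x*d) * (1 - x*e)"]
      show ?thesis unfolding p F' r0 r1 .
    qed
    finally show ?thesis by (rule mult_right_cancel[OF f3, THEN iffD1])
  qed
  have "r \<longlonglongrightarrow> 0"
  proof -
    obtain M where "M > 0" and bd: "\<forall>r s t u r' s' t' u' k. norm
       (qpoch (q^r*b) q k * qpoch (q^s*c) q k * qpoch (q^t*d) q k * qpoch (q^u*e) q k
        / (qpoch (q^r'*(q*a/b)) q k * qpoch (q^s'*(q*a/c)) q k * qpoch (q^t'*(q*a/d)) q k
          * qpoch (q^u'*(q*a/e)) q k)) \<le> M"
      using qpoch_quotient_bounded[OF q(2) den, of b c d e] by (elim exE conjE)
    from bd[rule_format, where r=0 and s=0 and t=0 and u=0 and r'=0 and s'=0 and t'=0 and u'=0]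
    have M: "norm (Q k) \<le> M" for k by (simp add: Q_def)
    have Mz: "(\<lambda>k. M * norm z ^ k) \<longlonglongrightarrow> 0"
      using z(2) by (intro tendsto_mult_right_zero LIMSEQ_power_zero) auto
    have Qz: "(\<lambda>k. Q k * z ^ k) \<longlonglongrightarrow> 0"
      by (rule Lim_null_comparison[OF _ Mz]) (auto simp: norm_mult norm_power M mult_right_mono)
    have qk: "(\<lambda>k. q ^ k) \<longlonglongrightarrow> 0" using q(2) by (rule LIMSEQ_power_zero)
    have "r \<longlonglongrightarrow> (1 - 0 * (z*b)) * (1 - 0 * a/b) * 0"
      unfolding r_def using nz(2) by (intro tendsto_intros qk Qz)
    then show ?thesis by simp
  qed
  then have "(\<lambda>k. r k - r (Suc k)) sums (r 0 - 0)"
    by (rule telescope_sums')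
  then have "(\<lambda>k. K * (V * vwp q (q*a) (q*b) c d e k) + (r k - r (Suc k))) sums (K * (V * S) + (r 0 - 0))"
    by (intro sums_add sums_mult S)
  then have "(\<lambda>k. (1 - z) * vwp q a b c d e k) sums (K * (V * S) + r 0)"
    by (simp add: eq)
  then have "(\<lambda>k. (1 - z) * vwp q a b c d e k / (1 - z)) sums ((K * (V * S) + r 0) / (1 - z))"
    by (rule sums_divide)
  moreover have "r 0 = (1 - z*b) * (1 - a/b)"
    by (simp add: r_def Q_def qpoch_def)
  moreover have "a/b * (1 - b) * (1 - q*a/(c*d)) * (1 - q*a/(c*e)) * (1 - q*a/(d*e))
      / ((1 - q*a/c) * (1 - q*a/d) * (1 - q*a/e)) * S = K * (V * S)"
    unfolding K_def V_def
    by (simp only: times_divide_eq_left times_divide_eq_right divide_divide_eq_left mult_ac)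
  moreover have "(\<lambda>k. (1 - z) * vwp q a b c d e k / (1 - z)) = vwp q a b c d e"
    using z1 by simp
  ultimately show ?thesis
    by (simp only: add.commute)
qed

lemma qpoch_shift_nonzero:
  assumes "\<And>k. qpoch x q k \<noteq> 0"
  shows "qpoch (q ^ j * x) q k \<noteq> 0"
  using assms[of "j + k"] by (simp add: qpoch_add)

section \<open>The series with argument \<open>q\<close>, summed by telescoping\<close>

text \<open>Because \<open>b*c*d*e = m^2\<close>, replacing each parameter \<open>y\<close> by
  \<open>m/y\<close> preserves the elementary symmetric functions of degrees 2 and 4. Only the terms
  in \<open>x\<close> and \<open>x^3\<close> survive in the difference; their coefficients have
  ratio \<open>-m\<close>, which produces the very-well-poised factor
  \<open>1 - x^2*m\<close>.\<close>

lemma vwp_balanced_poly: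
  fixes m b c d e x :: complex
  assumes "m \<noteq> 0" "b \<noteq> 0" "c \<noteq> 0" "d \<noteq> 0" and e: "e = m^2/(b*c*d)"
  shows "(1 - x*b) * (1 - x*c) * (1 - x*d) * (1 - x*e)
       - (1 - x*(m/b)) * (1 - x*(m/c)) * (1 - x*(m/d)) * (1 - x*(m/e))
    = b*c*d/m * (1 - m/(b*c)) * (1 - m/(b*d)) * (1 - m/(c*d)) * x * (1 - x^2*m)"
proof -
  define B C D N where "B = inverse b" and "C = inverse c" and "D = inverse d" and "N = inverse m"
  have i: "b * B = 1" "c * C = 1" "d * D = 1" "m * N = 1"
    using assms by (auto simp: B_def C_def D_def N_def)
  have me: "m / e = b*c*d*N"
    using assms by (simp add: N_def e divide_inverse power2_eq_square)
  have e': "e = m^2*B*C*D"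
    by (simp add: e B_def C_def D_def divide_inverse mult_ac)
  have "(1 - x*b) * (1 - x*c) * (1 - x*d) * (1 - x*(m^2*B*C*D))
       - (1 - x*(m*B)) * (1 - x*(m*C)) * (1 - x*(m*D)) * (1 - x*(b*c*d*N))
    = b*c*d*N * (1 - m*(B*C)) * (1 - m*(B*D)) * (1 - m*(C*D)) * x * (1 - x^2*m)"
    using i by algebra
  then show ?thesis
    unfolding me unfolding e' by (simp add: B_def C_def D_def N_def divide_inverse mult_ac)
qed

text \<open>The argument reduces to \<open>q\<close>, so its \<open>k\<close>-th power is the factor
  \<open>x\<close> in \<open>vwp_balanced_poly\<close>, and the summand becomes a difference of
  consecutive values of \<open>P\<close>. The constant stays inside the sum since it may vanish
  under these hypotheses.\<close>

lemma vwp_balanced_sums: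
  fixes q m b c d e :: complex
  assumes q: "norm q < 1" and nz: "m \<noteq> 0" "b \<noteq> 0" "c \<noteq> 0" "d \<noteq> 0"
    and e: "e = m^2/(b*c*d)"
    and den: "\<And>k. qpoch (q*m/b) q k \<noteq> 0" "\<And>k. qpoch (q*m/c) q k \<noteq> 0"
      "\<And>k. qpoch (q*m/d) q k \<noteq> 0" "\<And>k. qpoch (q*m/e) q k \<noteq> 0"
  shows "(\<lambda>k. b*c*d/m * (1 - m/(b*c)) * (1 - m/(b*d)) * (1 - m/(c*d)) * vwp q m b c d e k) sums
    (qpoch_inf b q * qpoch_inf c q * qpoch_inf d q * qpoch_inf e q
      / (qpoch_inf (q*m/b) q * qpoch_inf (q*m/c) q * qpoch_inf (q*m/d) q * qpoch_inf (q*m/e) q)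
     - (1 - m/b) * (1 - m/c) * (1 - m/d) * (1 - m/e))"
proof -
  define K where "K = b*c*d/m * (1 - m/(b*c)) * (1 - m/(b*d)) * (1 - m/(c*d))"
  define Q where "Q k = qpoch b q k * qpoch c q k * qpoch d q k * qpoch e q k
      / (qpoch (q*m/b) q k * qpoch (q*m/c) q k * qpoch (q*m/d) q k * qpoch (q*m/e) q k)" for k
  define P where "P k = Q k * ((1 - q^k*(m/b)) * (1 - q^k*(m/c)) * (1 - q^k*(m/d)) * (1 - q^k*(m/e)))" for k
  have z: "q*m^2/(b*c*d*e) = q"
    using nz by (simp add: e)
  have eq: "K * vwp q m b c d e k = P (Suc k) - P k" for k
  proof -
    define x where "x = q ^ k"
    have n: "1 - q^Suc k*(m/b) \<noteq> 0" "1 - q^Suc k*(m/c) \<noteq> 0" "1 - q^Suc k*(m/d) \<noteq> 0" "1 - q^Suc k*(m/e) \<noteq> 0"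
      using den(1)[of "Suc k"] den(2)[of "Suc k"] den(3)[of "Suc k"] den(4)[of "Suc k"]
      by (auto simp: qpoch_Suc mult_ac)
    define G where "G = (1 - q^Suc k*(m/b)) * (1 - q^Suc k*(m/c)) * (1 - q^Suc k*(m/d)) * (1 - q^Suc k*(m/e))"
    have G: "G \<noteq> 0" using n by (simp add: G_def)
    have s: "qpoch (q*m/y) q (Suc k) = qpoch (q*m/y) q k * (1 - q^Suc k*(m/y))" for y
      by (simp add: qpoch_Suc mult_ac)
    have "Q (Suc k) = Q k * ((1 - x*b) * (1 - x*c) * (1 - x*d) * (1 - x*e)) / G"
      unfolding Q_def s qpoch_Suc[of b] qpoch_Suc[of c] qpoch_Suc[of d] qpoch_Suc[of e] G_def x_def
      by (simp only: times_divide_times_eq times_divide_eq_left times_divide_eq_right divide_divide_eq_left mult_ac)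
    then have PS: "P (Suc k) = Q k * ((1 - x*b) * (1 - x*c) * (1 - x*d) * (1 - x*e))"
      unfolding P_def G_def[symmetric] using G by simp
    have "P (Suc k) - P k = Q k * ((1 - x*b) * (1 - x*c) * (1 - x*d) * (1 - x*e)
       - (1 - x*(m/b)) * (1 - x*(m/c)) * (1 - x*(m/d)) * (1 - x*(m/e)))"
      unfolding PS P_def[of k] x_def[symmetric] by (rule right_diff_distrib[symmetric])
    also have "\<dots> = Q k * (K * x * (1 - x^2*m))"
      unfolding vwp_balanced_poly[OF nz e] K_def ..
    also have "\<dots> = K * vwp q m b c d e k"
      unfolding vwp_def z by (simp add: Q_def x_def)
    finally show ?thesis ..
  qed
  have P0: "P 0 = (1 - m/b) * (1 - m/c) * (1 - m/d) * (1 - m/e)"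
    by (simp add: P_def Q_def qpoch_def)
  have inf: "qpoch_inf y q \<noteq> 0" if "\<And>k. qpoch y q k \<noteq> 0" for y
    using that q by (auto simp: qpoch_inf_eq_0_iff qpoch_eq_0_iff)
  have qk: "(\<lambda>k. q ^ k) \<longlonglongrightarrow> 0" using q by (rule LIMSEQ_power_zero)
  have "P \<longlonglongrightarrow> qpoch_inf b q * qpoch_inf c q * qpoch_inf d q * qpoch_inf e q
      / (qpoch_inf (q*m/b) q * qpoch_inf (q*m/c) q * qpoch_inf (q*m/d) q * qpoch_inf (q*m/e) q)
      * ((1 - 0*(m/b)) * (1 - 0*(m/c)) * (1 - 0*(m/d)) * (1 - 0*(m/e)))"
    unfolding P_def Q_def
    by (intro tendsto_intros qpoch_tendsto q qk) (simp add: inf den)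
  then have "(\<lambda>k. P (Suc k) - P k) sums
     (qpoch_inf b q * qpoch_inf c q * qpoch_inf d q * qpoch_inf e q
      / (qpoch_inf (q*m/b) q * qpoch_inf (q*m/c) q * qpoch_inf (q*m/d) q * qpoch_inf (q*m/e) q) - P 0)"
    by (intro telescope_sums) simp
  then show ?thesis
    unfolding eq[symmetric] P0 K_def .
qed

section \<open>One round of three contiguous steps\<close>

text \<open>Here \<open>x\<close> plays the role of \<open>q ^ n\<close>. The parameters
  \<open>c\<close>, \<open>b\<close>, \<open>d\<close> are raised in turn while \<open>e\<close>
  stays fixed; the arguments are \<open>q*x^3\<close>, \<open>q^2*x^3\<close>,
  \<open>q^3*x^3\<close>. Each \<open>u\<close> is an elementary term and each \<open>v\<close> the
  multiplier of the next series. The proof works backwards, from the series after the last step to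
  the first.\<close>

lemma vwp_sums_three_steps:
  fixes q a b c d e x S :: complex
  assumes q: "q \<noteq> 0" "norm q < 1" and nz: "a \<noteq> 0" "b \<noteq> 0" "c \<noteq> 0" "d \<noteq> 0" and x: "x \<noteq> 0" "norm x \<le> 1"
    and e: "e = q*a^2/(b*c*d)"
    and den: "\<And>k. qpoch (q*(x^2*(a/b))) q k \<noteq> 0" "\<And>k. qpoch (q*(x^2*(a/c))) q k \<noteq> 0"
      "\<And>k. qpoch (q*(x^2*(a/d))) q k \<noteq> 0" "\<And>k. qpoch (x^3*(b*c*d/a)) q k \<noteq> 0"
    and S: "vwp q (q^4*x^3*a) (q*x*b) (q*x*c) (q^2*x*d) e sums S"
  defines "u1 \<equiv> (1 - q*x^4*c) * (1 - q*x^2*(a/c)) / (1 - q*x^3)"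
    and "v1 \<equiv> q*x^2*(a/c) * (1 - x*c) * (1 - q*x*(a/(b*d))) * (1 - q*x^2*(c*d/a)) * (1 - x^2*(b*c/a))
      / ((1 - q*x^3) * (1 - q^2*x^2*(a/b)) * (1 - q*x^2*(a/d)) * (1 - q*x^3*(b*c*d/a)))"
    and "u2 \<equiv> (1 - q^2*x^4*b) * (1 - q^2*x^2*(a/b)) / (1 - q^2*x^3)"
    and "v2 \<equiv> q^2*x^2*(a/b) * (1 - x*b) * (1 - q*x*(a/(c*d))) * (1 - q*x^2*(b*d/a)) * (1 - q*x^2*(b*c/a))
      / ((1 - q^2*x^3) * (1 - q^2*x^2*(a/c)) * (1 - q^2*x^2*(a/d)) * (1 - q^2*x^3*(b*c*d/a)))"
    and "u3 \<equiv> (1 - q^4*x^4*d) * (1 - q^2*x^2*(a/d)) / (1 - q^3*x^3)"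
    and "v3 \<equiv> q^2*x^2*(a/d) * (1 - q*x*d) * (1 - q^2*x*(a/(b*c))) * (1 - q^2*x^2*(c*d/a)) * (1 - q^2*x^2*(b*d/a))
      / ((1 - q^3*x^3) * (1 - q^3*x^2*(a/b)) * (1 - q^3*x^2*(a/c)) * (1 - q^3*x^3*(b*c*d/a)))"
  shows "vwp q (q*x^3*a) (x*b) (x*c) (q*x*d) e sums (u1 + v1 * (u2 + v2 * (u3 + v3 * S)))"
proof -
  have e0: "e \<noteq> 0" using q nz by (simp add: e)
  note nzs = q(1) nz x(1) e0
  have small: "norm (q ^ Suc j * x ^ 3) < 1" for j
  proof -
    have "norm (q ^ Suc j * x ^ 3) = norm q ^ Suc j * norm x ^ 3" by (simp add: norm_mult norm_power)
    also have "\<dots> \<le> norm q ^ Suc j * 1"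
      using x(2) by (intro mult_left_mono) (auto intro: power_le_one)
    also have "\<dots> < 1" using q by (simp add: power_Suc_less_one del: power_Suc)
    finally show ?thesis .
  qed
  have b': "qpoch (q^Suc j * (x^2*(a/b))) q k \<noteq> 0" for j k
    using qpoch_shift_nonzero[OF den(1), of j k] by (simp add: mult_ac)
  have c': "qpoch (q^Suc j * (x^2*(a/c))) q k \<noteq> 0" for j k
    using qpoch_shift_nonzero[OF den(2), of j k] by (simp add: mult_ac)
  have d': "qpoch (q^Suc j * (x^2*(a/d))) q k \<noteq> 0" for j k
    using qpoch_shift_nonzero[OF den(3), of j k] by (simp add: mult_ac)
  have e': "qpoch (q^j * (x^3*(b*c*d/a))) q k \<noteq> 0" for j k
    using qpoch_shift_nonzero[OF den(4), of j k] by (simp add: mult_ac)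
  have sm: "norm (q * x ^ 3) < 1" "norm (q^2 * x ^ 3) < 1" "norm (q^3 * x ^ 3) < 1"
    using small[of 0] small[of 1] small[of 2] by (simp_all add: eval_nat_numeral)
  note ns = power2_eq_square power3_eq_cube power4_eq_xxxx

  have S3: "vwp q (q^3*x^3*a) (q*x*d) (q*x*b) (q*x*c) e sums (u3 + v3 * S)"
  proof -
    have ar: "q*(q^3*x^3*a)/(q*x*d) = q^Suc 2*(x^2*(a/d))" "q*(q^3*x^3*a)/(q*x*b) = q^Suc 2*(x^2*(a/b))"
      "q*(q^3*x^3*a)/(q*x*c) = q^Suc 2*(x^2*(a/c))" "q*(q^3*x^3*a)/e = q^3*(x^3*(b*c*d/a))"
      using nzs by (simp_all add: e ns field_simps)
    \<comment> \<open>The contiguous relation raises the first parameter, so symmetry is used to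
      bring \<open>d\<close> to the front; likewise for \<open>b\<close> and \<open>c\<close>
      below.\<close>
    have "q*(q^3*x^3*a) = q^4*x^3*a" "q*(q*x*d) = q^2*x*d" by (simp_all add: ns)
    with S have step: "vwp q (q*(q^3*x^3*a)) (q*(q*x*d)) (q*x*b) (q*x*c) e sums S"
      by (simp only: vwp_commute(2))
    have "vwp q (q^3*x^3*a) (q*x*d) (q*x*b) (q*x*c) e sums
     (((1 - q^3*x^3*(q*x*d)) * (1 - q^3*x^3*a/(q*x*d)) + q^3*x^3*a/(q*x*d) * (1 - q*x*d)
         * (1 - q*(q^3*x^3*a)/((q*x*b)*(q*x*c))) * (1 - q*(q^3*x^3*a)/((q*x*b)*e)) * (1 - q*(q^3*x^3*a)/((q*x*c)*e))
      / ((1 - q*(q^3*x^3*a)/(q*x*b)) * (1 - q*(q^3*x^3*a)/(q*x*c)) * (1 - q*(q^3*x^3*a)/e)) * S) / (1 - q^3*x^3))"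
      \<comment> \<open>Unfolding \<open>ar\<close> brings the denominator parameters into the form
        of the nonvanishing facts; the remaining side conditions are nonzero parameters and the
        value of the argument.\<close>
      by (intro vwp_sums_contiguous; (unfold ar)?;
        (rule step q b' c' d' e' sm | assumption | use nzs in \<open>simp add: e field_simps ns; fail\<close>))
    also have "q^3*x^3*a/(q*x*d) = q^2*x^2*(a/d)" using nzs by (simp add: ns)
    also have "q*(q^3*x^3*a)/((q*x*b)*(q*x*c)) = q^2*x*(a/(b*c))" using nzs by (simp add: ns)
    also have "q*(q^3*x^3*a)/((q*x*b)*e) = q^2*x^2*(c*d/a)" using nzs by (simp add: e ns)
    also have "q*(q^3*x^3*a)/((q*x*c)*e) = q^2*x^2*(b*d/a)" using nzs by (simp add: e ns)
    also have "q^3*x^3*(q*x*d) = q^4*x^4*d" by (simp add: ns)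
    finally show ?thesis unfolding u3_def v3_def ar
      by (simp add: add_divide_distrib mult_ac ns)
  qed
  have S2: "vwp q (q^2*x^3*a) (x*b) (q*x*c) (q*x*d) e sums (u2 + v2 * (u3 + v3 * S))"
  proof -
    have ar: "q*(q^2*x^3*a)/(x*b) = q^Suc 2*(x^2*(a/b))" "q*(q^2*x^3*a)/(q*x*c) = q^Suc 1*(x^2*(a/c))"
      "q*(q^2*x^3*a)/(q*x*d) = q^Suc 1*(x^2*(a/d))" "q*(q^2*x^3*a)/e = q^2*(x^3*(b*c*d/a))"
      using nzs by (simp_all add: e ns field_simps)
    have "q*(q^2*x^3*a) = q^3*x^3*a" "q*(x*b) = q*x*b" by (simp_all add: ns)
    with S3 have step: "vwp q (q*(q^2*x^3*a)) (q*(x*b)) (q*x*c) (q*x*d) e sums (u3 + v3 * S)"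
      by (simp only: vwp_commute(2))
    have "vwp q (q^2*x^3*a) (x*b) (q*x*c) (q*x*d) e sums
     (((1 - q^2*x^3*(x*b)) * (1 - q^2*x^3*a/(x*b)) + q^2*x^3*a/(x*b) * (1 - x*b)
         * (1 - q*(q^2*x^3*a)/((q*x*c)*(q*x*d))) * (1 - q*(q^2*x^3*a)/((q*x*c)*e)) * (1 - q*(q^2*x^3*a)/((q*x*d)*e))
      / ((1 - q*(q^2*x^3*a)/(q*x*c)) * (1 - q*(q^2*x^3*a)/(q*x*d)) * (1 - q*(q^2*x^3*a)/e)) * (u3 + v3 * S)) / (1 - q^2*x^3))"
      by (intro vwp_sums_contiguous; (unfold ar)?;
        (rule step q b' c' d' e' sm | assumption | use nzs in \<open>simp add: e field_simps ns; fail\<close>))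
    also have "q^2*x^3*a/(x*b) = q^2*x^2*(a/b)" using nzs by (simp add: ns)
    also have "q*(q^2*x^3*a)/((q*x*c)*(q*x*d)) = q*x*(a/(c*d))" using nzs by (simp add: ns)
    also have "q*(q^2*x^3*a)/((q*x*c)*e) = q*x^2*(b*d/a)" using nzs by (simp add: e ns)
    also have "q*(q^2*x^3*a)/((q*x*d)*e) = q*x^2*(b*c/a)" using nzs by (simp add: e ns)
    also have "q^2*x^3*(x*b) = q^2*x^4*b" by (simp add: ns)
    finally show ?thesis unfolding u2_def v2_def ar
      by (simp add: add_divide_distrib mult_ac ns)
  qed
  have ar: "q*(q*x^3*a)/(x*c) = q^Suc 1*(x^2*(a/c))" "q*(q*x^3*a)/(x*b) = q^Suc 1*(x^2*(a/b))"
    "q*(q*x^3*a)/(q*x*d) = q^Suc 0*(x^2*(a/d))" "q*(q*x^3*a)/e = q^1*(x^3*(b*c*d/a))"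
    using nzs by (simp_all add: e ns field_simps)
  have "q*(q*x^3*a) = q^2*x^3*a" "q*(x*c) = q*x*c" by (simp_all add: ns)
  with S2 have step: "vwp q (q*(q*x^3*a)) (q*(x*c)) (x*b) (q*x*d) e sums (u2 + v2 * (u3 + v3 * S))"
    by (simp only: vwp_commute(1))
  have "vwp q (q*x^3*a) (x*c) (x*b) (q*x*d) e sums
   (((1 - q*x^3*(x*c)) * (1 - q*x^3*a/(x*c)) + q*x^3*a/(x*c) * (1 - x*c)
       * (1 - q*(q*x^3*a)/((x*b)*(q*x*d))) * (1 - q*(q*x^3*a)/((x*b)*e)) * (1 - q*(q*x^3*a)/((q*x*d)*e))
    / ((1 - q*(q*x^3*a)/(x*b)) * (1 - q*(q*x^3*a)/(q*x*d)) * (1 - q*(q*x^3*a)/e)) * (u2 + v2 * (u3 + v3 * S))) / (1 - q*x^3))"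
    by (intro vwp_sums_contiguous; (unfold ar)?;
      (rule step q b' c' d' e' sm | assumption | use nzs in \<open>simp add: e field_simps ns; fail\<close>))
  also have "q*x^3*a/(x*c) = q*x^2*(a/c)" using nzs by (simp add: ns)
  also have "q*(q*x^3*a)/((x*b)*(q*x*d)) = q*x*(a/(b*d))" using nzs by (simp add: ns)
  also have "q*(q*x^3*a)/((x*b)*e) = q*x^2*(c*d/a)" using nzs by (simp add: e ns)
  also have "q*(q*x^3*a)/((q*x*d)*e) = x^2*(b*c/a)" using nzs by (simp add: e ns)
  also have "q*x^3*(x*c) = q*x^4*c" by (simp add: ns)
  finally have "vwp q (q*x^3*a) (x*c) (x*b) (q*x*d) e sums (u1 + v1 * (u2 + v2 * (u3 + v3 * S)))"
    unfolding u1_def v1_def ar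
    by (simp add: add_divide_distrib mult_ac ns)
  then show ?thesis by (simp only: vwp_commute(1))
qed

section \<open>Ratios and decay of the terms of the expansion\<close>

lemma qpoch_inf_shift:
  assumes "norm q < 1"
  shows "qpoch_inf x q = (1 - x) * qpoch_inf (q * x) q"
proof (rule LIMSEQ_unique)
  show "(\<lambda>n. qpoch x q (Suc n)) \<longlonglongrightarrow> qpoch_inf x q"
    using qpoch_tendsto[OF assms] by (rule LIMSEQ_Suc)
  show "(\<lambda>n. qpoch x q (Suc n)) \<longlonglongrightarrow> (1 - x) * qpoch_inf (q * x) q"
    unfolding qpoch_Suc_shift by (intro tendsto_intros qpoch_tendsto assms)
qed

lemma Bseq_qpoch:
  assumes "norm q < 1"
  shows "Bseq (\<lambda>n. qpoch x q (g n))"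
proof -
  obtain M where "M > 0" and M: "\<And>m n. norm (qpoch (q ^ m * x) q n) \<le> M"
    using qpoch_bounded[OF assms] by blast
  from M[of 0] show ?thesis by (intro BseqI'[of _ M]) simp
qed

lemma Bseq_inverse_qpoch:
  assumes "norm q < 1" "\<And>k. qpoch x q k \<noteq> 0"
  shows "Bseq (\<lambda>n. inverse (qpoch x q (g n)))"
proof -
  obtain M where "M > 0" and M: "\<And>m n. norm (inverse (qpoch (q ^ m * x) q n)) \<le> M"
    using qpoch_bounded_below[OF assms] by blast
  from M[of 0] show ?thesis by (intro BseqI'[of _ M]) simp
qed

lemma qpoch_2_Suc:
  "qpoch y q (2 * Suc n) = qpoch y q (2 * n) * (1 - (q^n)^2 * y) * (1 - q * (q^n)^2 * y)"
proof -
  have "2 * Suc n = Suc (Suc (2 * n))" by simp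
  then show ?thesis by (simp only: qpoch_Suc power_Suc power_even_eq)
qed

lemma qpoch_3_Suc:
  "qpoch y q (3 * Suc n) = qpoch y q (3 * n) * (1 - (q^n)^3 * y) * (1 - q * (q^n)^3 * y) * (1 - q^2 * (q^n)^3 * y)"
proof -
  have "3 * Suc n = Suc (Suc (Suc (3 * n)))" by simp
  moreover have "q ^ (3 * n) = (q ^ n) ^ 3" by (metis mult.commute power_mult)
  ultimately show ?thesis by (simp only: qpoch_Suc power_Suc power2_eq_square mult.assoc)
qed

text \<open>The summand of the expansion without \<open>W\<close>. Its ratio of consecutive terms is
  rational in \<open>q ^ n\<close>, and it records the accumulated multipliers of the contiguous
  steps up to a normalization.\<close>

definition series_factor :: "complex \<Rightarrow> complex \<Rightarrow> complex \<Rightarrow> complex \<Rightarrow> complex \<Rightarrow> nat \<Rightarrow> complex" where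
  "series_factor q a b c d n =
     (q ^ (3*n) * a^3 / (b*c*d)) ^ n
          * (qpochs [b, c, q*d, q*a/(b*c), q*a/(b*d), q*a/(c*d)] q n
             * qpochs [b*c/a, b*d/a, c*d/a] q (2*n))
          / (qpochs [q*a/b, q*a/c, q*a/d] q (2*n) * qpochs [q, b*c*d/a] q (3*n))"

lemma series_factor_Suc:
  fixes q a b c d :: complex and n :: nat
  defines "x \<equiv> q ^ n"
  shows "series_factor q a b c d (Suc n) = series_factor q a b c d n *
    (q^3 * x^6 * a^3 / (b*c*d)
     * ((1 - x*b) * (1 - x*c) * (1 - q*x*d) * (1 - q*x*(a/(b*c))) * (1 - q*x*(a/(b*d))) * (1 - q*x*(a/(c*d)))
      * (1 - x^2*(b*c/a)) * (1 - q*x^2*(b*c/a)) * (1 - x^2*(b*d/a)) * (1 - q*x^2*(b*d/a))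
      * (1 - x^2*(c*d/a)) * (1 - q*x^2*(c*d/a)))
     / ((1 - q*x^2*(a/b)) * (1 - q^2*x^2*(a/b)) * (1 - q*x^2*(a/c)) * (1 - q^2*x^2*(a/c))
      * (1 - q*x^2*(a/d)) * (1 - q^2*x^2*(a/d)) * (1 - q*x^3) * (1 - q^2*x^3) * (1 - q^3*x^3)
      * (1 - x^3*(b*c*d/a)) * (1 - q*x^3*(b*c*d/a)) * (1 - q^2*x^3*(b*c*d/a))))"
proof -
  define A where "A = a^3 / (b*c*d)"
  have x3: "q ^ (3*n) = x^3" by (simp add: x_def power_mult[symmetric] mult.commute)
  have "(q ^ (3*Suc n) * A) ^ Suc n = (q^3 * (x^3 * A)) ^ n * (q^3 * x^3 * A)"
    using x3 by (simp add: power_add mult_ac eval_nat_numeral)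
  \<comment> \<open>The factor \<open>(q^3)^n\<close> equals \<open>x^3\<close>, which raises the
    power of \<open>x\<close> in the ratio from 3 to 6.\<close>
  also have "\<dots> = (x^3 * A) ^ n * (q^3 * x^6 * A)"
  proof -
    have "(q^3) ^ n = x^3" unfolding x_def by (metis mult.commute power_mult)
    moreover have "x^6 = x^3 * x^3" by (simp flip: power_add)
    ultimately show ?thesis by (simp add: power_mult_distrib[of "q^3"])
  qed
  finally have p: "(q ^ (3*Suc n) * a^3 / (b*c*d)) ^ Suc n = (q ^ (3*n) * a^3 / (b*c*d)) ^ n * (q^3 * x^6 * (a^3 / (b*c*d)))"
    unfolding x3 by (simp add: A_def)
  have s1: "qpoch (q*a/y) q (Suc n) = qpoch (q*a/y) q n * (1 - q*x*(a/y))"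
    "qpoch (q*d) q (Suc n) = qpoch (q*d) q n * (1 - q*x*d)"
    "qpoch b q (Suc n) = qpoch b q n * (1 - x*b)" "qpoch c q (Suc n) = qpoch c q n * (1 - x*c)" for y
    by (simp_all add: qpoch_Suc x_def mult_ac)
  have s2: "qpoch (q*a/y) q (2*Suc n) = qpoch (q*a/y) q (2*n) * ((1 - q*x^2*(a/y)) * (1 - q^2*x^2*(a/y)))"
    "qpoch (w/a) q (2*Suc n) = qpoch (w/a) q (2*n) * ((1 - x^2*(w/a)) * (1 - q*x^2*(w/a)))" for y w
    unfolding qpoch_2_Suc x_def[symmetric] by (simp_all add: power2_eq_square mult_ac)
  have s3: "qpoch q q (3*Suc n) = qpoch q q (3*n) * ((1 - q*x^3) * (1 - q^2*x^3) * (1 - q^3*x^3))"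
    "qpoch (w/a) q (3*Suc n) = qpoch (w/a) q (3*n) * ((1 - x^3*(w/a)) * (1 - q*x^3*(w/a)) * (1 - q^2*x^3*(w/a)))" for w
    unfolding qpoch_3_Suc x_def[symmetric] by (simp_all add: power2_eq_square power3_eq_cube mult_ac)
  show ?thesis
    unfolding series_factor_def qpochs_def p
    by (simp only: list.map prod_list.Cons prod_list.Nil mult_1_right s1 s2 s3)
      (simp only: times_divide_times_eq times_divide_eq_left times_divide_eq_right divide_divide_eq_left mult_ac)
qed

lemma W_power_form:
  fixes q a b c d :: complex and n :: nat
  defines "x \<equiv> q ^ n"
  shows "W q n a b c d =
     ((1 - x^2*(b*d/a)) * (1 - q*x*(a/(b*c))) * (1 - x^2*(c*d/a)) * (1 - q*x^4*c))
     / ((1 - q*x^3) * (1 - c) * (1 - q*x^2*(a/b)) * (1 - x^3*(b*c*d/a)))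
     * (x^2 * (a/d)
        + ((1 - x^2*(a/d)) * (1 - x^3*(b*c*d/a)) * (1 - x^4*d) * (1 - q*x^2*(a/b)) * (1 - q*x^3))
          / ((1 - x*d) * (1 - x^2*(b*d/a)) * (1 - x^2*(c*d/a)) * (1 - q*x*(a/(b*c))) * (1 - q*x^4*c))
        + (q*x^4 * a^2 * (1 - x*c) * (1 - x^2*(b*c/a)) * (1 - q*x*(a/(b*d))) * (1 - q*x^2*(c*d/a)) * (1 - q^2*x^4*b))
          / (c * d * (1 - q*x^2*(a/c)) * (1 - q*x^2*(a/d)) * (1 - q*x^3*(b*c*d/a)) * (1 - q^2*x^3) * (1 - q*x^4*c)))"
proof -
  have e: "q ^ (2*n) = x^2" "q ^ (3*n) = x^3" "q ^ (4*n) = x^4"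
    by (simp_all add: x_def power_mult[symmetric] mult.commute)
  show ?thesis
    unfolding W_def power_add e x_def[symmetric] by simp
qed

text \<open>Here \<open>f y\<close> stands for \<open>1 - y\<close>; leaving \<open>f\<close> opaque keeps the simplifier from
  multiplying out the factors, so that both sides only have to be compared as monomials.\<close>

lemma step_coefficient_identities:
  fixes f :: "complex \<Rightarrow> complex" and q a b c d x :: complex
  assumes nz: "q \<noteq> 0" "a \<noteq> 0" "b \<noteq> 0" "c \<noteq> 0" "d \<noteq> 0" "x \<noteq> 0"
    and fz: "f (q*x^3) \<noteq> 0" "f (q^2*x^3) \<noteq> 0" "f (q^3*x^3) \<noteq> 0"
      "f (q*x^2*(a/b)) \<noteq> 0" "f (q^2*x^2*(a/b)) \<noteq> 0" "f (q^3*x^2*(a/b)) \<noteq> 0"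
      "f (q*x^2*(a/c)) \<noteq> 0" "f (q^2*x^2*(a/c)) \<noteq> 0" "f (q^3*x^2*(a/c)) \<noteq> 0"
      "f (q*x^2*(a/d)) \<noteq> 0" "f (q^2*x^2*(a/d)) \<noteq> 0"
      "f (x^3*(b*c*d/a)) \<noteq> 0" "f (q*x^3*(b*c*d/a)) \<noteq> 0" "f (q^2*x^3*(b*c*d/a)) \<noteq> 0" "f (q^3*x^3*(b*c*d/a)) \<noteq> 0"
      "f (x*d) \<noteq> 0" "f (q*x*d) \<noteq> 0" "f c \<noteq> 0" "f (q*x^4*c) \<noteq> 0"
      "f (x^2*(b*d/a)) \<noteq> 0" "f (x^2*(c*d/a)) \<noteq> 0" "f (q*x*(a/(b*c))) \<noteq> 0"
  defines "u1 \<equiv> f (q*x^4*c) * f (q*x^2*(a/c)) / f (q*x^3)"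
    and "v1 \<equiv> q*x^2*(a/c) * f (x*c) * f (q*x*(a/(b*d))) * f (q*x^2*(c*d/a)) * f (x^2*(b*c/a))
      / (f (q*x^3) * f (q^2*x^2*(a/b)) * f (q*x^2*(a/d)) * f (q*x^3*(b*c*d/a)))"
    and "u2 \<equiv> f (q^2*x^4*b) * f (q^2*x^2*(a/b)) / f (q^2*x^3)"
    and "v2 \<equiv> q^2*x^2*(a/b) * f (x*b) * f (q*x*(a/(c*d))) * f (q*x^2*(b*d/a)) * f (q*x^2*(b*c/a))
      / (f (q^2*x^3) * f (q^2*x^2*(a/c)) * f (q^2*x^2*(a/d)) * f (q^2*x^3*(b*c*d/a)))"
    and "u3 \<equiv> f (q^4*x^4*d) * f (q^2*x^2*(a/d)) / f (q^3*x^3)"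
    and "v3 \<equiv> q^2*x^2*(a/d) * f (q*x*d) * f (q^2*x*(a/(b*c))) * f (q^2*x^2*(c*d/a)) * f (q^2*x^2*(b*d/a))
      / (f (q^3*x^3) * f (q^3*x^2*(a/b)) * f (q^3*x^2*(a/c)) * f (q^3*x^3*(b*c*d/a)))"
    and "\<rho> \<equiv> q^3 * x^6 * a^3 / (b*c*d)
     * (f (x*b) * f (x*c) * f (q*x*d) * f (q*x*(a/(b*c))) * f (q*x*(a/(b*d))) * f (q*x*(a/(c*d)))
      * f (x^2*(b*c/a)) * f (q*x^2*(b*c/a)) * f (x^2*(b*d/a)) * f (q*x^2*(b*d/a))
      * f (x^2*(c*d/a)) * f (q*x^2*(c*d/a)))
     / (f (q*x^2*(a/b)) * f (q^2*x^2*(a/b)) * f (q*x^2*(a/c)) * f (q^2*x^2*(a/c))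
      * f (q*x^2*(a/d)) * f (q^2*x^2*(a/d)) * f (q*x^3) * f (q^2*x^3) * f (q^3*x^3)
      * f (x^3*(b*c*d/a)) * f (q*x^3*(b*c*d/a)) * f (q^2*x^3*(b*c*d/a)))"
    and "S \<equiv> f (x^2*(a/d)) * f (x^4*d) / f (x*d)"
    and "X \<equiv> x^2*(a/d) * f (q*x*(a/(b*c))) * f (x^2*(b*d/a)) * f (x^2*(c*d/a))
      / (f (q*x^2*(a/b)) * f (q*x^2*(a/c)) * f (x^3*(b*c*d/a)))"
    and "S' \<equiv> f (q^2*x^2*(a/d)) * f (q^4*x^4*d) / f (q*x*d)"
    and "X' \<equiv> q^2*x^2*(a/d) * f (q^2*x*(a/(b*c))) * f (q^2*x^2*(b*d/a)) * f (q^2*x^2*(c*d/a))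
      / (f (q^3*x^2*(a/b)) * f (q^3*x^2*(a/c)) * f (q^3*x^3*(b*c*d/a)))"
  shows "X * v1 * v2 * v3 = \<rho> * X'"
    and "X * v1 * v2 * u3 = \<rho> * S'"
    and "S + X * (u1 + v1 * u2) = f c * (
     (f (x^2*(b*d/a)) * f (q*x*(a/(b*c))) * f (x^2*(c*d/a)) * f (q*x^4*c))
     / (f (q*x^3) * f c * f (q*x^2*(a/b)) * f (x^3*(b*c*d/a)))
     * (x^2 * (a/d)
        + (f (x^2*(a/d)) * f (x^3*(b*c*d/a)) * f (x^4*d) * f (q*x^2*(a/b)) * f (q*x^3))
          / (f (x*d) * f (x^2*(b*d/a)) * f (x^2*(c*d/a)) * f (q*x*(a/(b*c))) * f (q*x^4*c))
        + (q*x^4 * a^2 * f (x*c) * f (x^2*(b*c/a)) * f (q*x*(a/(b*d))) * f (q*x^2*(c*d/a)) * f (q^2*x^4*b))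
          / (c * d * f (q*x^2*(a/c)) * f (q*x^2*(a/d)) * f (q*x^3*(b*c*d/a)) * f (q^2*x^3) * f (q*x^4*c))))"
proof -
  \<comment> \<open>The three multipliers of a round carry the normalization \<open>X\<close> to the
    next one, up to the term ratio \<open>\<rho>\<close>.\<close>
  show "X * v1 * v2 * v3 = \<rho> * X'"
    unfolding X_def v1_def v2_def v3_def \<rho>_def X'_def
    by (simp only: times_divide_times_eq times_divide_eq_left times_divide_eq_right divide_divide_eq_left)
      (simp add: nz fz power2_eq_square eval_nat_numeral divide_simps)
  \<comment> \<open>The elementary term of the third step is handed over to the next round as its
    \<open>S\<close>.\<close>
  show "X * v1 * v2 * u3 = \<rho> * S'"
    unfolding X_def v1_def v2_def u3_def \<rho>_def S'_def
    using nz fz by (simp add: divide_simps eval_nat_numeral)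
  \<comment> \<open>\<open>X * u1\<close>, \<open>S\<close> and \<open>X * v1 * u2\<close> match the
    three summands of \<open>W\<close> in the order in which they are written there.\<close>
  show "S + X * (u1 + v1 * u2) = f c * (
     (f (x^2*(b*d/a)) * f (q*x*(a/(b*c))) * f (x^2*(c*d/a)) * f (q*x^4*c))
     / (f (q*x^3) * f c * f (q*x^2*(a/b)) * f (x^3*(b*c*d/a)))
     * (x^2 * (a/d)
        + (f (x^2*(a/d)) * f (x^3*(b*c*d/a)) * f (x^4*d) * f (q*x^2*(a/b)) * f (q*x^3))
          / (f (x*d) * f (x^2*(b*d/a)) * f (x^2*(c*d/a)) * f (q*x*(a/(b*c))) * f (q*x^4*c))
        + (q*x^4 * a^2 * f (x*c) * f (x^2*(b*c/a)) * f (q*x*(a/(b*d))) * f (q*x^2*(c*d/a)) * f (q^2*x^4*b))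
          / (c * d * f (q*x^2*(a/c)) * f (q*x^2*(a/d)) * f (q*x^3*(b*c*d/a)) * f (q^2*x^3) * f (q*x^4*c))))"
    unfolding S_def X_def u1_def v1_def u2_def
    using nz fz by (simp add: divide_simps eval_nat_numeral) (simp add: algebra_simps)
qed

text \<open>All symbols and the inverses of those in the denominator are bounded. The decay comes
  from the \<open>n\<close>-th power, whose base tends to 0 and is thus eventually below 1/2 in
  norm.\<close>

lemma series_factor_tendsto_0:
  fixes q a b c d :: complex
  assumes q: "norm q < 1"
    and nz: "\<And>k. qpoch (q*a/b) q k \<noteq> 0" "\<And>k. qpoch (q*a/c) q k \<noteq> 0" "\<And>k. qpoch (q*a/d) q k \<noteq> 0"
      "\<And>k. qpoch q q k \<noteq> 0" "\<And>k. qpoch (b*c*d/a) q k \<noteq> 0"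
  shows "series_factor q a b c d \<longlonglongrightarrow> 0"
proof -
  have "norm (q^3) < 1" using q by (simp add: norm_power power_less_one_iff)
  then have "(\<lambda>n. (q^3)^n * (a^3/(b*c*d))) \<longlonglongrightarrow> 0"
    by (intro tendsto_mult_left_zero LIMSEQ_power_zero)
  then have A: "(\<lambda>n. q^(3*n) * a^3/(b*c*d)) \<longlonglongrightarrow> 0"
    by (simp add: power_mult)
  then have ev: "eventually (\<lambda>n. norm (q^(3*n) * a^3/(b*c*d)) < 1/2) sequentially"
    by (auto dest: tendstoD[where e = "1/2"] simp: dist_norm)
  have p: "(\<lambda>n. (q^(3*n) * a^3/(b*c*d))^n) \<longlonglongrightarrow> 0"
  proof (rule Lim_null_comparison)
    show "eventually (\<lambda>n. norm ((q^(3*n) * a^3/(b*c*d))^n) \<le> (1/2)^n) sequentially"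
      using ev by eventually_elim (unfold norm_power, intro power_mono, auto)
    show "(\<lambda>n. (1/2::real)^n) \<longlonglongrightarrow> 0" by (intro LIMSEQ_power_zero) simp
  qed
  define B where "B n = qpoch b q n * qpoch c q n * qpoch (q*d) q n
      * qpoch (q*a/(b*c)) q n * qpoch (q*a/(b*d)) q n * qpoch (q*a/(c*d)) q n
      * qpoch (b*c/a) q (2*n) * qpoch (b*d/a) q (2*n) * qpoch (c*d/a) q (2*n)
      * inverse (qpoch (q*a/b) q (2*n)) * inverse (qpoch (q*a/c) q (2*n)) * inverse (qpoch (q*a/d) q (2*n))
      * inverse (qpoch q q (3*n)) * inverse (qpoch (b*c*d/a) q (3*n))" for n
  have "Bseq B"
    unfolding B_def by (intro Bseq_mult Bseq_qpoch Bseq_inverse_qpoch q nz)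
  then obtain K where "\<And>n. norm (B n) \<le> K" by (auto simp: Bseq_def)
  then have "(\<lambda>n. (q^(3*n) * a^3/(b*c*d))^n * B n) \<longlonglongrightarrow> 0"
    by (intro lim_null_mult_right_bounded[OF p] always_eventually allI)
  moreover have "series_factor q a b c d = (\<lambda>n. (q^(3*n) * a^3/(b*c*d))^n * B n)"
    unfolding series_factor_def qpochs_def B_def divide_inverse inverse_mult_distrib
    by (simp only: list.map prod_list.Cons prod_list.Nil mult_1_left mult_1_right inverse_1 inverse_mult_distrib mult_ac)
  ultimately show ?thesis by simp
qed

section \<open>Iteration of the rounds and evaluation of the initial remainder\<close>

theorem theorem7:
  fixes q a b c d :: complex
  assumes q: "0 < norm q" "norm q < 1"
    and nonzero: "a \<noteq> 0" "b \<noteq> 0" "c \<noteq> 0" "d \<noteq> 0"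
    and denom_lhs:
      "qpoch_inf (q*a/b) q \<noteq> 0" "qpoch_inf (q*a/c) q \<noteq> 0"
      "qpoch_inf (q*a/d) q \<noteq> 0" "qpoch_inf (b*c*d/a) q \<noteq> 0"
    and denom_rhs:
      "\<And>n. qpochs [q*a/b, q*a/c, q*a/d] q (2*n) \<noteq> 0"
      "\<And>n. qpochs [q, b*c*d/a] q (3*n) \<noteq> 0"
    and denom_W_prefactor:
      "\<And>n. 1 - q ^ (1+3*n) \<noteq> 0"
      "1 - c \<noteq> 0"
      "\<And>n. 1 - q ^ (1+2*n) * (a/b) \<noteq> 0"
      "\<And>n. 1 - q ^ (3*n) * (b*c*d/a) \<noteq> 0"
    and denom_W_second:
      "\<And>n. 1 - q ^ n * d \<noteq> 0"
      "\<And>n. 1 - q ^ (2*n) * (b*d/a) \<noteq> 0"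
      "\<And>n. 1 - q ^ (2*n) * (c*d/a) \<noteq> 0"
      "\<And>n. 1 - q ^ (1+n) * (a/(b*c)) \<noteq> 0"
      "\<And>n. 1 - q ^ (1+4*n) * c \<noteq> 0"
    and denom_W_third:
      "\<And>n. 1 - q ^ (1+2*n) * (a/c) \<noteq> 0"
      "\<And>n. 1 - q ^ (1+2*n) * (a/d) \<noteq> 0"
      "\<And>n. 1 - q ^ (1+3*n) * (b*c*d/a) \<noteq> 0"
      "\<And>n. 1 - q ^ (2+3*n) \<noteq> 0"
  shows
    "(\<lambda>n. W q n a b c d * (q ^ (3*n) * a^3 / (b*c*d)) ^ n
          * (qpochs [b, c, q*d, q*a/(b*c), q*a/(b*d), q*a/(c*d)] q n
             * qpochs [b*c/a, b*d/a, c*d/a] q (2*n))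
          / (qpochs [q*a/b, q*a/c, q*a/d] q (2*n) * qpochs [q, b*c*d/a] q (3*n)))
     sums
       ((qpoch_inf b q * qpoch_inf (q*c) q * qpoch_inf (q*d) q * qpoch_inf (q*a^2/(b*c*d)) q)
        / (qpoch_inf (q*a/b) q * qpoch_inf (q*a/c) q * qpoch_inf (q*a/d) q
           * qpoch_inf (b*c*d/a) q))"
proof -
  \<comment> \<open>This value gives \<open>F 0\<close> the argument \<open>q\<close>, so that
    \<open>vwp_balanced_sums\<close> applies to it.\<close>
  define e where "e = q*a^2/(b*c*d)"
  define f :: "complex \<Rightarrow> complex" where "f y = 1 - y" for y
  define X where "X x = x^2*(a/d) * f (q*x*(a/(b*c))) * f (x^2*(b*d/a)) * f (x^2*(c*d/a))
      / (f (q*x^2*(a/b)) * f (q*x^2*(a/c)) * f (x^3*(b*c*d/a)))" for x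
  define S where "S x = f (x^2*(a/d)) * f (x^4*d) / f (x*d)" for x
  define F where "F n = vwp q (q*(q^n)^3*a) (q^n*b) (q^n*c) (q*q^n*d) e" for n
  define \<Omega> where "\<Omega> n = suminf (F n)" for n
  \<comment> \<open>\<open>R n\<close> is the remainder after \<open>n\<close> rounds, scaled by
    \<open>1 - c\<close>. It includes \<open>S\<close>, the elementary term inherited from the
    preceding round.\<close>
  define R where "R n = series_factor q a b c d n * (S (q^n) + X (q^n) * \<Omega> n)" for n

  have q0: "q \<noteq> 0" using q(1) by auto
  have e0: "e \<noteq> 0" using q0 nonzero by (simp add: e_def)
  have fin: "qpoch y q k \<noteq> 0" if "qpoch_inf y q \<noteq> 0" for y k
    using that q(2) by (auto simp: qpoch_inf_eq_0_iff qpoch_eq_0_iff)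
  have nb: "qpoch (q*a/b) q k \<noteq> 0" and nc: "qpoch (q*a/c) q k \<noteq> 0"
    and nd: "qpoch (q*a/d) q k \<noteq> 0" and ne: "qpoch (b*c*d/a) q k \<noteq> 0" for k
    by (rule fin, fact)+
  have fac: "1 - q^k*y \<noteq> 0" if "\<And>k. qpoch y q k \<noteq> 0" for y k
    using that[of "Suc k"] by (simp add: qpoch_Suc)
  have fb: "f (q^Suc k*(a/b)) \<noteq> 0" and fc: "f (q^Suc k*(a/c)) \<noteq> 0"
    and fd: "f (q^Suc k*(a/d)) \<noteq> 0" and fe: "f (q^k*(b*c*d/a)) \<noteq> 0" for k
    using fac[OF nb, of k] fac[OF nc, of k] fac[OF nd, of k] fac[OF ne, of k]
    by (simp_all add: f_def mult_ac)
  have fq: "f (q^Suc k) \<noteq> 0" for k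
  proof -
    have "norm (q ^ Suc k) < 1" using q by (simp add: norm_power power_Suc_less_one del: power_Suc)
    then show ?thesis unfolding f_def by (metis norm_one order_less_irrefl right_minus_eq)
  qed
  have nq: "qpoch q q k \<noteq> 0" for k
    using fq by (auto simp: qpoch_def f_def mult.commute)

  \<comment> \<open>The argument of \<open>F n\<close> is \<open>q*(q^n)^3\<close>, of norm at most
    \<open>norm q\<close>, and all parameters except \<open>e\<close> are shifted by powers of
    \<open>q\<close>; hence one geometric majorant works for every \<open>n\<close>.\<close>
  have M: "\<exists>M. \<forall>n k. norm (F n k) \<le> M * norm q ^ k"
  proof -
    obtain M where "M > 0" and bd: "\<forall>r s t u r' s' t' u' k. norm
       (qpoch (q^r*b) q k * qpoch (q^s*c) q k * qpoch (q^t*d) q k * qpoch (q^u*e) q k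
        / (qpoch (q^r'*(q*a/b)) q k * qpoch (q^s'*(q*a/c)) q k * qpoch (q^t'*(q*a/d)) q k
          * qpoch (q^u'*(b*c*d/a)) q k)) \<le> M"
      using qpoch_quotient_bounded[OF q(2) nb nc nd ne, of b c d e] by (elim exE conjE)
    have "norm (F n k) \<le> (1 + norm a) * M * norm q ^ k" for n k
    proof -
      define x where "x = q ^ n"
      have x: "x \<noteq> 0" "norm x \<le> 1"
        using q0 q(2) by (auto simp: x_def norm_power power_le_one)
      have x3: "norm x ^ 3 \<le> 1" using x(2) by (simp add: power_le_one)
      have ar: "q*(q*x^3*a)/(x*b) = q^Suc (2*n)*(q*a/b)" "q*(q*x^3*a)/(x*c) = q^Suc (2*n)*(q*a/c)"
        "q*(q*x^3*a)/(q*x*d) = q^(2*n)*(q*a/d)" "q*(q*x^3*a)/e = q^Suc (3*n)*(b*c*d/a)"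
        using q0 nonzero x(1)
        by (simp_all add: e_def field_simps power2_eq_square power3_eq_cube x_def power_add
              flip: power_mult power_add mult_2)
      have z: "q*(q*x^3*a)^2/((x*b)*(x*c)*(q*x*d)*e) = q*x^3"
        using q0 nonzero x(1) by (simp add: e_def field_simps eval_nat_numeral)
      have "norm (F n k) \<le> (1 + norm (q*x^3*a)) * M * norm (q*x^3) ^ k"
        unfolding F_def x_def[symmetric]
      proof (rule order_trans[OF norm_vwp_le[OF q(2), where M = M]])
        show "norm (qpoch (x*b) q k * qpoch (x*c) q k * qpoch (q*x*d) q k * qpoch e q k /
          (qpoch (q*(q*x^3*a)/(x*b)) q k * qpoch (q*(q*x^3*a)/(x*c)) q k * qpoch (q*(q*x^3*a)/(q*x*d)) q k
           * qpoch (q*(q*x^3*a)/e) q k)) \<le> M"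
          unfolding ar using bd[rule_format, where r=n and s=n and t="Suc n" and u=0 and r'="Suc (2*n)"
            and s'="Suc (2*n)" and t'="2*n" and u'="Suc (3*n)" and k=k]
          by (simp add: x_def mult.assoc)
      qed (simp add: z)
      also have "\<dots> \<le> (1 + norm a) * M * norm q ^ k"
      proof (intro mult_mono power_mono)
        have "norm q * norm x ^ 3 * norm a \<le> 1 * 1 * norm a"
          using q(2) x3 by (intro mult_mono) auto
        then show "1 + norm (q*x^3*a) \<le> 1 + norm a" by (simp add: norm_mult norm_power)
        show "norm (q * x ^ 3) \<le> norm q"
          using x3 by (simp add: norm_mult norm_power mult_left_le)
      qed (use \<open>M > 0\<close> in auto)
      finally show ?thesis .
    qed
    then show ?thesis by blast
  qed
  then obtain M where M: "\<And>n k. norm (F n k) \<le> M * norm q ^ k" by blast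
  have geo: "summable (\<lambda>k. M * norm q ^ k)"
    using q(2) by (intro summable_mult summable_geometric) simp
  have sF: "F n sums \<Omega> n" for n
    unfolding \<Omega>_def using summable_comparison_test'[OF geo, of 0 "F n"] M by (simp add: summable_sums)
  have "norm (\<Omega> n) \<le> (\<Sum>k. M * norm q ^ k)" for n
    unfolding \<Omega>_def by (intro norm_suminf_le geo M)
  then have B\<Omega>: "Bseq \<Omega>" by (rule BseqI')

  have rec: "R n - R (Suc n) = (1 - c) * (W q n a b c d * series_factor q a b c d n)" for n
  proof -
    define x where "x = q ^ n"
    have x: "x \<noteq> 0" "norm x \<le> 1"
      using q0 q(2) by (auto simp: x_def norm_power power_le_one)
    have pw: "q ^ (2*n) = x^2" "q ^ (3*n) = x^3" "q ^ (4*n) = x^4"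
      by (simp_all add: x_def power_mult[symmetric] mult.commute)
    have fz: "f (q*x^3) \<noteq> 0" "f (q^2*x^3) \<noteq> 0" "f (q^3*x^3) \<noteq> 0"
      "f (q*x^2*(a/b)) \<noteq> 0" "f (q^2*x^2*(a/b)) \<noteq> 0" "f (q^3*x^2*(a/b)) \<noteq> 0"
      "f (q*x^2*(a/c)) \<noteq> 0" "f (q^2*x^2*(a/c)) \<noteq> 0" "f (q^3*x^2*(a/c)) \<noteq> 0"
      "f (q*x^2*(a/d)) \<noteq> 0" "f (q^2*x^2*(a/d)) \<noteq> 0"
      "f (x^3*(b*c*d/a)) \<noteq> 0" "f (q*x^3*(b*c*d/a)) \<noteq> 0" "f (q^2*x^3*(b*c*d/a)) \<noteq> 0" "f (q^3*x^3*(b*c*d/a)) \<noteq> 0"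
      "f (x*d) \<noteq> 0" "f (q*x*d) \<noteq> 0" "f c \<noteq> 0" "f (q*x^4*c) \<noteq> 0"
      "f (x^2*(b*d/a)) \<noteq> 0" "f (x^2*(c*d/a)) \<noteq> 0" "f (q*x*(a/(b*c))) \<noteq> 0"
    proof -
      show "f (q*x^3) \<noteq> 0" "f (q^2*x^3) \<noteq> 0" "f (q^3*x^3) \<noteq> 0"
        using fq[of "3*n"] fq[of "Suc (3*n)"] fq[of "Suc (Suc (3*n))"]
        by (simp_all add: pw power2_eq_square power3_eq_cube mult.assoc)
      show "f (q*x^2*(a/b)) \<noteq> 0" "f (q^2*x^2*(a/b)) \<noteq> 0" "f (q^3*x^2*(a/b)) \<noteq> 0"
        using fb[of "2*n"] fb[of "Suc (2*n)"] fb[of "Suc (Suc (2*n))"]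
        by (simp_all add: pw power2_eq_square power3_eq_cube mult.assoc)
      show "f (q*x^2*(a/c)) \<noteq> 0" "f (q^2*x^2*(a/c)) \<noteq> 0" "f (q^3*x^2*(a/c)) \<noteq> 0"
        using fc[of "2*n"] fc[of "Suc (2*n)"] fc[of "Suc (Suc (2*n))"]
        by (simp_all add: pw power2_eq_square power3_eq_cube mult.assoc)
      show "f (q*x^2*(a/d)) \<noteq> 0" "f (q^2*x^2*(a/d)) \<noteq> 0"
        using fd[of "2*n"] fd[of "Suc (2*n)"]
        by (simp_all add: pw power2_eq_square mult.assoc)
      show "f (x^3*(b*c*d/a)) \<noteq> 0" "f (q*x^3*(b*c*d/a)) \<noteq> 0" "f (q^2*x^3*(b*c*d/a)) \<noteq> 0" "f (q^3*x^3*(b*c*d/a)) \<noteq> 0"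
        using fe[of "3*n"] fe[of "Suc (3*n)"] fe[of "Suc (Suc (3*n))"] fe[of "Suc (Suc (Suc (3*n)))"]
        by (simp_all add: pw power2_eq_square power3_eq_cube mult.assoc)
      \<comment> \<open>\<open>f (q*x*d)\<close> is the denominator of \<open>S\<close> in the next
        round, so its hypothesis is taken at \<open>Suc n\<close>.\<close>
      show "f (x*d) \<noteq> 0" "f (q*x*d) \<noteq> 0" "f c \<noteq> 0" "f (q*x^4*c) \<noteq> 0"
        "f (x^2*(b*d/a)) \<noteq> 0" "f (x^2*(c*d/a)) \<noteq> 0" "f (q*x*(a/(b*c))) \<noteq> 0"
        using denom_W_second(1)[of n] denom_W_second(1)[of "Suc n"] denom_W_prefactor(2)
          denom_W_second(5)[of n] denom_W_second(2-4)[of n]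
        by (simp_all add: f_def pw x_def[symmetric])
    qed
    define u1 where "u1 = f (q*x^4*c) * f (q*x^2*(a/c)) / f (q*x^3)"
    define v1 where "v1 = q*x^2*(a/c) * f (x*c) * f (q*x*(a/(b*d))) * f (q*x^2*(c*d/a)) * f (x^2*(b*c/a))
      / (f (q*x^3) * f (q^2*x^2*(a/b)) * f (q*x^2*(a/d)) * f (q*x^3*(b*c*d/a)))"
    define u2 where "u2 = f (q^2*x^4*b) * f (q^2*x^2*(a/b)) / f (q^2*x^3)"
    define v2 where "v2 = q^2*x^2*(a/b) * f (x*b) * f (q*x*(a/(c*d))) * f (q*x^2*(b*d/a)) * f (q*x^2*(b*c/a))
      / (f (q^2*x^3) * f (q^2*x^2*(a/c)) * f (q^2*x^2*(a/d)) * f (q^2*x^3*(b*c*d/a)))"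
    define u3 where "u3 = f (q^4*x^4*d) * f (q^2*x^2*(a/d)) / f (q^3*x^3)"
    define v3 where "v3 = q^2*x^2*(a/d) * f (q*x*d) * f (q^2*x*(a/(b*c))) * f (q^2*x^2*(c*d/a)) * f (q^2*x^2*(b*d/a))
      / (f (q^3*x^3) * f (q^3*x^2*(a/b)) * f (q^3*x^2*(a/c)) * f (q^3*x^3*(b*c*d/a)))"
    define \<rho> where "\<rho> = q^3 * x^6 * a^3 / (b*c*d)
     * (f (x*b) * f (x*c) * f (q*x*d) * f (q*x*(a/(b*c))) * f (q*x*(a/(b*d))) * f (q*x*(a/(c*d)))
      * f (x^2*(b*c/a)) * f (q*x^2*(b*c/a)) * f (x^2*(b*d/a)) * f (q*x^2*(b*d/a))
      * f (x^2*(c*d/a)) * f (q*x^2*(c*d/a)))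
     / (f (q*x^2*(a/b)) * f (q^2*x^2*(a/b)) * f (q*x^2*(a/c)) * f (q^2*x^2*(a/c))
      * f (q*x^2*(a/d)) * f (q^2*x^2*(a/d)) * f (q*x^3) * f (q^2*x^3) * f (q^3*x^3)
      * f (x^3*(b*c*d/a)) * f (q*x^3*(b*c*d/a)) * f (q^2*x^3*(b*c*d/a)))"
    have S': "S (q*x) = f (q^2*x^2*(a/d)) * f (q^4*x^4*d) / f (q*x*d)"
      by (simp add: S_def power_mult_distrib)
    have X': "X (q*x) = q^2*x^2*(a/d) * f (q^2*x*(a/(b*c))) * f (q^2*x^2*(b*d/a)) * f (q^2*x^2*(c*d/a))
      / (f (q^3*x^2*(a/b)) * f (q^3*x^2*(a/c)) * f (q^3*x^3*(b*c*d/a)))"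
    proof -
      have "q*(q*x) = q^2*x" "q*(q*x)^2 = q^3*x^2" "(q*x)^2 = q^2*x^2" "(q*x)^3 = q^3*x^3"
        by (simp_all add: eval_nat_numeral)
      then show ?thesis by (simp only: X_def)
    qed
    note id = step_coefficient_identities[of q a b c d x f, OF q0 nonzero x(1) fz,
      folded u1_def v1_def u2_def v2_def u3_def v3_def \<rho>_def X_def S_def, folded S' X']
    have factor_Suc: "series_factor q a b c d (Suc n) = series_factor q a b c d n * \<rho>"
      unfolding series_factor_Suc \<rho>_def f_def x_def ..
    have Wc: "(1 - c) * W q n a b c d = S x + X x * (u1 + v1 * u2)"
      unfolding W_power_form x_def[symmetric] f_def[symmetric] by (rule id(3)[symmetric])
    have "F (Suc n) = vwp q (q^4*x^3*a) (q*x*b) (q*x*c) (q^2*x*d) e"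
    proof -
      have "q*(q^Suc n)^3 = q^4*x^3" "q^Suc n = q*x" "q*q^Suc n = q^2*x"
        by (simp_all add: x_def eval_nat_numeral)
      then show ?thesis by (simp only: F_def)
    qed
    then have next_sums: "vwp q (q^4*x^3*a) (q*x*b) (q*x*c) (q^2*x*d) e sums \<Omega> (Suc n)"
      using sF[of "Suc n"] by simp
    have "vwp q (q*x^3*a) (x*b) (x*c) (q*x*d) e sums (u1 + v1 * (u2 + v2 * (u3 + v3 * \<Omega> (Suc n))))"
      unfolding u1_def v1_def u2_def v2_def u3_def v3_def f_def
    proof (rule vwp_sums_three_steps[OF q0 q(2) nonzero x e_def _ _ _ _ next_sums])
      fix k
      show "qpoch (q*(x^2*(a/b))) q k \<noteq> 0" "qpoch (q*(x^2*(a/c))) q k \<noteq> 0" "qpoch (q*(x^2*(a/d))) q k \<noteq> 0"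
        "qpoch (x^3*(b*c*d/a)) q k \<noteq> 0"
        using qpoch_shift_nonzero[OF nb, of "2*n" k] qpoch_shift_nonzero[OF nc, of "2*n" k]
          qpoch_shift_nonzero[OF nd, of "2*n" k] qpoch_shift_nonzero[OF ne, of "3*n" k]
        unfolding pw by (simp_all add: mult_ac)
    qed
    then have \<Omega>n: "\<Omega> n = u1 + v1 * (u2 + v2 * (u3 + v3 * \<Omega> (Suc n)))"
      using sF[of n] unfolding F_def x_def by (rule sums_unique2[rotated])
    \<comment> \<open>The first bracket is the current \<open>W\<close> term; the rest is
      \<open>\<rho>\<close> times the same expression at \<open>q*x\<close>.\<close>
    have "S x + X x * \<Omega> n
       = (S x + X x * (u1 + v1 * u2)) + X x * v1 * v2 * u3 + X x * v1 * v2 * v3 * \<Omega> (Suc n)"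
      unfolding \<Omega>n by (simp only: distrib_left mult.assoc add.assoc)
    also have "\<dots> = (1 - c) * W q n a b c d + \<rho> * (S (q*x) + X (q*x) * \<Omega> (Suc n))"
      unfolding id(1) id(2) Wc by (simp only: distrib_left mult.assoc add.assoc)
    finally have "R n = series_factor q a b c d n * ((1 - c) * W q n a b c d + \<rho> * (S (q*x) + X (q*x) * \<Omega> (Suc n)))"
      unfolding R_def x_def by simp
    moreover have "R (Suc n) = series_factor q a b c d n * \<rho> * (S (q*x) + X (q*x) * \<Omega> (Suc n))"
      unfolding R_def factor_Suc by (simp add: x_def)
    ultimately show ?thesis by (simp add: algebra_simps)
  qed

  have "R \<longlonglongrightarrow> 0"
  proof -
    have qk: "(\<lambda>n. q ^ n) \<longlonglongrightarrow> 0" using q(2) by (rule LIMSEQ_power_zero)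
    \<comment> \<open>At 0 every denominator of \<open>S\<close> and \<open>X\<close> equals
      1.\<close>
    have "isCont S 0" "isCont X 0"
      unfolding S_def f_def X_def by (intro continuous_intros; simp)+
    then have lim: "(\<lambda>n. S (q ^ n)) \<longlonglongrightarrow> S 0" "(\<lambda>n. X (q ^ n)) \<longlonglongrightarrow> X 0"
      by (auto intro: isCont_tendsto_compose[OF _ qk])
    note lim0 = series_factor_tendsto_0[OF q(2) nb nc nd nq ne]
    note S0 = tendsto_mult[OF lim0 lim(1)] and X0 = tendsto_mult[OF lim0 lim(2), unfolded mult_zero_left]
    obtain K where "\<And>n. norm (\<Omega> n) \<le> K" using B\<Omega> by (auto simp: Bseq_def)
    then have "(\<lambda>n. series_factor q a b c d n * X (q^n) * \<Omega> n) \<longlonglongrightarrow> 0"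
      by (intro lim_null_mult_right_bounded[OF X0] always_eventually allI)
    from tendsto_add[OF S0 this] show ?thesis
      by (simp add: R_def[abs_def] distrib_left mult.assoc)
  qed
  have R0: "R 0 = (1 - c) * ((qpoch_inf b q * qpoch_inf (q*c) q * qpoch_inf (q*d) q * qpoch_inf (q*a^2/(b*c*d)) q)
        / (qpoch_inf (q*a/b) q * qpoch_inf (q*a/c) q * qpoch_inf (q*a/d) q * qpoch_inf (b*c*d/a) q))"
  proof -
    have ar: "q*(q*a)/b = q*(q*a/b)" "q*(q*a)/c = q*(q*a/c)" "q*(q*a)/(q*d) = q*a/d"
      "q*(q*a)/e = q*(b*c*d/a)" "q*a/(q*d) = a/d" "q*a/e = b*c*d/a"
      "q*a/(b*(q*d)) = a/(b*d)" "q*a/(c*(q*d)) = a/(c*d)" "b*c*(q*d)/(q*a) = b*c*d/a"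
      using q0 nonzero by (simp_all add: e_def field_simps power2_eq_square)
    \<comment> \<open>\<open>g\<close> collects the factors split off when the three shifted
      infinite products in the denominator are rewritten; the same factors occur in the boundary
      term of \<open>vwp_balanced_sums\<close> with \<open>m = q*a\<close>.\<close>
    define g where "g = f (q*a/b) * f (q*a/c) * f (b*c*d/a)"
    have g0: "f (q*a/b) \<noteq> 0" "f (q*a/c) \<noteq> 0" "f (b*c*d/a) \<noteq> 0"
      using fb[of 0] fc[of 0] fe[of 0] by simp_all
    have d0: "f d \<noteq> 0" using denom_W_second(1)[of 0] by (simp add: f_def)
    define P where "P = qpoch_inf b q * qpoch_inf (q*c) q * qpoch_inf (q*d) q * qpoch_inf e q
        / (qpoch_inf (q*a/b) q * qpoch_inf (q*a/c) q * qpoch_inf (q*a/d) q * qpoch_inf (b*c*d/a) q)"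
    define K where "K = b*c*d/a * f (q*a/(b*c)) * f (a/(b*d)) * f (a/(c*d))"
    have sh: "qpoch_inf (q*a/b) q = f (q*a/b) * qpoch_inf (q*(q*a/b)) q"
      "qpoch_inf (q*a/c) q = f (q*a/c) * qpoch_inf (q*(q*a/c)) q"
      "qpoch_inf (b*c*d/a) q = f (b*c*d/a) * qpoch_inf (q*(b*c*d/a)) q"
      "qpoch_inf c q = f c * qpoch_inf (q*c) q"
      unfolding f_def by (rule qpoch_inf_shift[OF q(2)])+
    have e_bal: "e = (q*a)^2/(b*c*(q*d))"
      using q0 by (simp add: e_def power2_eq_square mult_ac)
    have "(\<lambda>k. b*c*(q*d)/(q*a) * (1 - q*a/(b*c)) * (1 - q*a/(b*(q*d))) * (1 - q*a/(c*(q*d))) * vwp q (q*a) b c (q*d) e k) sums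
      (qpoch_inf b q * qpoch_inf c q * qpoch_inf (q*d) q * qpoch_inf e q
        / (qpoch_inf (q*(q*a)/b) q * qpoch_inf (q*(q*a)/c) q * qpoch_inf (q*(q*a)/(q*d)) q * qpoch_inf (q*(q*a)/e) q)
       - (1 - q*a/b) * (1 - q*a/c) * (1 - q*a/(q*d)) * (1 - q*a/e))"
      using q0 nonzero qpoch_shift_nonzero[OF nb, of 1] qpoch_shift_nonzero[OF nc, of 1] qpoch_shift_nonzero[OF ne, of 1]
      by (intro vwp_balanced_sums[OF q(2) _ _ _ _ e_bal]) (unfold ar, simp_all add: nd)
    then have "(\<lambda>k. K * F 0 k) sums
      (qpoch_inf b q * qpoch_inf c q * qpoch_inf (q*d) q * qpoch_inf e q
        / (qpoch_inf (q*(q*a/b)) q * qpoch_inf (q*(q*a/c)) q * qpoch_inf (q*a/d) q * qpoch_inf (q*(b*c*d/a)) q)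
       - g * f (a/d))"
      unfolding ar by (simp add: K_def F_def f_def g_def mult_ac)
    moreover have "(\<lambda>k. K * F 0 k) sums (K * \<Omega> 0)" by (intro sums_mult sF)
    ultimately have "K * \<Omega> 0 = qpoch_inf b q * qpoch_inf c q * qpoch_inf (q*d) q * qpoch_inf e q
        / (qpoch_inf (q*(q*a/b)) q * qpoch_inf (q*(q*a/c)) q * qpoch_inf (q*a/d) q * qpoch_inf (q*(b*c*d/a)) q)
       - g * f (a/d)"
      by (rule sums_unique2[rotated])
    also have "\<dots> = g * (f c * P - f (a/d))"
      unfolding P_def sh g_def using g0 by (simp add: right_diff_distrib mult_ac)
    finally have K\<Omega>: "K * \<Omega> 0 = g * (f c * P - f (a/d))" .
    have "g * X 1 = a/d * f (q*a/(b*c)) * f (b*d/a) * f (c*d/a)"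
      unfolding X_def g_def using g0 by simp
    \<comment> \<open>\<open>1 - a/(b*d)\<close> is \<open>-a/(b*d)\<close> times
      \<open>1 - b*d/a\<close>, and similarly with \<open>c\<close> for \<open>b\<close>; the two
      signs cancel.\<close>
    also have "\<dots> = K"
      using nonzero by (simp add: K_def f_def field_simps)
    finally have gX: "g * X 1 = K" .
    have "g * (X 1 * \<Omega> 0) = g * (f c * P - f (a/d))"
      unfolding K\<Omega>[symmetric] gX[symmetric] by (rule mult.assoc[symmetric])
    moreover have "g \<noteq> 0" using g0 by (simp add: g_def)
    ultimately have "X 1 * \<Omega> 0 = f c * P - f (a/d)" by simp
    \<comment> \<open>The initial \<open>S\<close> cancels the boundary term \<open>f (a/d)\<close>
      and leaves the pure product.\<close>
    moreover have "S 1 = f (a/d)" using d0 by (simp add: S_def)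
    moreover have "series_factor q a b c d 0 = 1" by (simp add: series_factor_def qpochs_def qpoch_def)
    ultimately have "R 0 = f c * P" by (simp add: R_def)
    then show ?thesis by (simp only: f_def P_def e_def)
  qed
  have "(\<lambda>n. R n - R (Suc n)) sums (R 0 - 0)"
    using \<open>R \<longlonglongrightarrow> 0\<close> by (rule telescope_sums')
  then have "(\<lambda>n. (1 - c) * (W q n a b c d * series_factor q a b c d n) / (1 - c)) sums (R 0 / (1 - c))"
    unfolding rec by (intro sums_divide) simp
  then show ?thesis
    using denom_W_prefactor(2) by (simp add: R0 series_factor_def mult.assoc)
qed

end
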